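(* Let $\alpha\in(0,1)$ and let $\phi_\alpha(t)=t^{-1/(1+\alpha)}$. Then $\mathbf{P}$-almost surely, \[\limsup_{t\to\infty}\frac{p_t^\omega(0,0)}{\phi_\alpha(t)(\log\log t)^{\frac{1-\alpha}{1+\alpha}}}\in(0,\infty),\] and \[\liminf_{t\to\infty}\frac{p_t^\omega(0,0)\,(\log t)^{\theta}}{\phi_\alpha(t)}=0 \text{ if } \theta=\tfrac{1}{1+\alpha},\qquad \liminf_{t\to\infty}\frac{p_t^\omega(0,0)\,(\log t)^{\theta}}{\phi_\alpha(t)}=\infty \text{ if } \theta>\tfrac{3}{\alpha}.\]
   Context: One-dimensional symmetric Bouchaud trap model. Fix $\alpha>0$. Let $\tau=\{\tau_x\}_{x\in\mathbb{Z}}$ be i.i.d. random variables (the random environment, with law $\mathbf{P}$ and expectation $\mathbf{E}$; $\omega$ denotes a realisation of the environment) with $\mathbf{P}(\tau_x>u)=u^{-\alpha}$ for all $u\ge 1$. Given $\tau$, let $X=(X_t)_{t\ge0}$ be the continuous-time Markov chain on $\mathbb{Z}$ with generator $\mathcal{L}f(x)=\frac{1}{2\tau_x}\sum_{y\sim x}(f(y)-f(x))$ (sum over the two nearest neighbours of $x$); i.e. $X$ waits at $x$ an exponential time with mean $\tau_x$ and then jumps to a uniformly chosen neighbour. Write $P^\omega_x$ for the quenched law of $X$ started at $x$. The measure $\sum_x\tau_x\delta_x$ is reversible/invariant for $X$, and the quenched heat kernel is $p_t^\omega(x,y)=P^\omega_x(X_t=y)/\tau_y$. *)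

theory Defs
  imports "HOL-Probability.Probability"
begin

text \<open>Quenched law of the Bouchaud trap model, built from the jump chain and the holding times.
  A nearest-neighbour path with n jumps is a list of n+1 sites.\<close>

definition nn_paths :: "nat \<Rightarrow> int \<Rightarrow> int \<Rightarrow> int list set" where
  "nn_paths n x y = {xs. length xs = Suc n \<and> xs ! 0 = x \<and> xs ! n = y \<and>
                         (\<forall>i<n. \<bar>xs ! Suc i - xs ! i\<bar> = 1)}"

definition holding_law :: "(int \<Rightarrow> real) \<Rightarrow> int list \<Rightarrow> (nat \<Rightarrow> real) measure" where
  "holding_law tau xs =
     PiM {..<length xs} (\<lambda>i. density lborel (exponential_density (1 / tau (xs ! i))))"

text \<open>Probability that the walk, having followed the path xs (n = length xs - 1 jumps),
  is at its last site at time t: the first n holding times sum to at most t and the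
  first n+1 sum to more than t.\<close>
definition hold_prob :: "(int \<Rightarrow> real) \<Rightarrow> int list \<Rightarrow> real \<Rightarrow> real" where
  "hold_prob tau xs t =
     measure (holding_law tau xs)
       {e \<in> space (holding_law tau xs).
          (\<Sum>i<length xs - 1. e i) \<le> t \<and> t < (\<Sum>i<length xs. e i)}"

definition trans_prob :: "(int \<Rightarrow> real) \<Rightarrow> int \<Rightarrow> int \<Rightarrow> real \<Rightarrow> real" where
  "trans_prob tau x y t =
     (\<Sum>n. \<Sum>xs\<in>nn_paths n x y. (1/2) ^ n * hold_prob tau xs t)"

definition heat_kernel :: "(int \<Rightarrow> real) \<Rightarrow> real \<Rightarrow> int \<Rightarrow> int \<Rightarrow> real" where
  "heat_kernel tau t x y = trans_prob tau x y t / tau y"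

definition phi_alpha :: "real \<Rightarrow> real \<Rightarrow> real" where
  "phi_alpha \<alpha> t = t powr (- 1 / (1 + \<alpha>))"

end

theory Submission
  imports Defs "HOL-Real_Asymp.Real_Asymp"
begin

text \<open>Write \<open>V(r)\<close> for the total depth of the traps in \<open>[0, r]\<close>, \<open>V'(r)\<close> for that in \<open>[-r, r]\<close>, and
  \<open>p\<close> for the return heat kernel. The expected local time \<open>G\<close> at the origin up to time \<open>t\<close> is the
  value at 0 of a Green function whose slope is bounded and whose mass on \<open>[0, r]\<close> is at most \<open>t\<close>, so
  \<open>G \<le> t / V(r) + C r\<close>. Since \<open>p\<close> decreases, \<open>p \<le> 1 / V(r) + C r / t\<close>. Conversely, testing the walk
  against the tent function of radius \<open>R = G\<close> shows that it is still in \<open>[-R, R]\<close> with probability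
  at least 1/2, and Cauchy-Schwarz gives \<open>p \<ge> c / V'(R)\<close>.

  Everything else concerns sums of independent heavy-tailed variables. Almost surely \<open>V(r)\<close> is
  eventually at least \<open>c r powr (1/\<alpha>) (ln ln r) powr (-(1-\<alpha>)/\<alpha>)\<close>, with the reverse bound for \<open>V'\<close>
  infinitely often, which gives the limsup; a single exceptionally deep trap makes \<open>V(r)\<close> larger than
  any multiple of \<open>(r ln r) powr (1/\<alpha>)\<close> infinitely often, which gives the vanishing liminf; and
  \<open>V'(r) \<le> r powr (1/\<alpha>) (ln r) powr (2/\<alpha>)\<close> eventually, which gives the infinite one.\<close>

section \<open>The walk in discrete time\<close>

text \<open>The log-log exponent comes from a balance. With \<open>V(r)\<close> at its smallest, of
  order \<open>r powr (1/\<alpha>) * (ln ln t) powr (-(1-\<alpha>)/\<alpha>)\<close>, the terms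
  \<open>1 / V(r)\<close> and \<open>r / t\<close> agree when \<open>r\<close> is of order \<open>t
  powr (\<alpha>/(1+\<alpha>)) * (ln ln t) powr ((1-\<alpha>)/(1+\<alpha>))\<close>, and
  \<open>r / t\<close> is then the normaliser of the limsup. Likewise a trap of depth
  \<open>v\<close> at distance \<open>n\<close> is felt at time \<open>n * v\<close>, where both
  terms are of order \<open>1 / v\<close>. The kernel of the definitions is a series over paths of
  probabilities about sums of unequal exponential times, in which neither symmetry nor monotonicity
  is visible. The estimates are therefore proved for a discrete kernel of finite support, where
  every summation by parts is a finite sum, and then averaged over a Poisson number of steps. The
  link with the path series is the renewal equation given by the first holding time and jump: the
  series is its Picard iteration, and \<tau> \<ge> 1 makes the error shrink geometrically on bounded
  time intervals.\<close>

definition lap :: "(int \<Rightarrow> real) \<Rightarrow> int \<Rightarrow> real" where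
  "lap f x = f (x - 1) + f (x + 1) - 2 * f x"

text \<open>Iterates of \<open>Q = I + L/2\<close>, where \<open>L\<close> is the generator. Running \<open>Q\<close> at the jump times of a
  Poisson process of rate 2 gives the walk in continuous time. Since \<open>\<tau> \<ge> 1\<close>, rate 1 would do, but
  halving the steps makes \<open>Q\<close> positive, hence its return probabilities monotone. The factor \<open>1 / \<tau> 0\<close> turns
  probabilities into the heat kernel.\<close>

primrec disc_kernel :: "(int \<Rightarrow> real) \<Rightarrow> nat \<Rightarrow> int \<Rightarrow> real" where
  "disc_kernel \<tau> 0 x = (if x = 0 then 1 / \<tau> 0 else 0)"
| "disc_kernel \<tau> (Suc n) x = disc_kernel \<tau> n x + lap (disc_kernel \<tau> n) x / (4 * \<tau> x)"

declare disc_kernel.simps(2) [simp del]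

definition green :: "(int \<Rightarrow> real) \<Rightarrow> nat \<Rightarrow> int \<Rightarrow> real" where
  "green \<tau> n x = (\<Sum>k<n. disc_kernel \<tau> k x)"

lemma disc_kernel_outside: "int n < \<bar>x\<bar> \<Longrightarrow> disc_kernel \<tau> n x = 0"
proof (induction n arbitrary: x)
  case (Suc n)
  have "disc_kernel \<tau> n y = 0" if "\<bar>y - x\<bar> \<le> 1" for y
    using that Suc.prems by (intro Suc.IH) linarith
  from this[of x] this[of "x-1"] this[of "x+1"] show ?case
    by (simp add: disc_kernel.simps lap_def)
qed auto

lemma sum_shift_int:
  fixes f :: "int \<Rightarrow> real"
  assumes "f (- N - 1) = 0" "f N = 0" "N \<ge> 0"
  shows "(\<Sum>x=-N..N. f x) = (\<Sum>x=-N..N. f (x - 1))"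
proof -
  have "(\<Sum>x=-N..N. f (x - 1)) = (\<Sum>x=-N-1..N-1. f x)"
    by (rule sum.reindex_bij_witness[of _ "\<lambda>x. x + 1" "\<lambda>x. x - 1"]) auto
  also have "\<dots> = (\<Sum>x\<in>{-N..N-1}. f x)"
  proof (intro sum.mono_neutral_right ballI)
    fix x assume "x \<in> {-N-1..N-1} - {-N..N-1}"
    then have "x = - N - 1" by auto
    then show "f x = 0" using assms by simp
  qed auto
  also have "\<dots> = (\<Sum>x=-N..N. f x)"
  proof (intro sum.mono_neutral_left ballI)
    fix x assume "x \<in> {-N..N} - {-N..N-1}"
    then have "x = N" by auto
    then show "f x = 0" using assms by simp
  qed auto
  finally show ?thesis ..
qed

text \<open>Summation by parts. \<open>f\<close> vanishes from the endpoints on, which kills every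
  boundary term whatever \<open>g\<close> does; so \<open>g\<close> may be the constant 1
  (conservation of mass) or a tent function.\<close>

lemma sum_lap_commute:
  fixes f g :: "int \<Rightarrow> real"
  assumes f: "\<And>x. \<bar>x\<bar> \<ge> N \<Longrightarrow> f x = 0" and N: "N \<ge> 0"
  shows "(\<Sum>x=-N..N. f x * lap g x) = (\<Sum>x=-N..N. lap f x * g x)"
proof -
  have "(\<Sum>x=-N..N. f x * g (x + 1)) = (\<Sum>x=-N..N. f (x - 1) * g x)"
    using sum_shift_int[of "\<lambda>x. f x * g (x + 1)" N] f[of "- N - 1"] f[of N] N by simp
  moreover have "(\<Sum>x=-N..N. f (x + 1) * g x) = (\<Sum>x=-N..N. f x * g (x - 1))"
    using sum_shift_int[of "\<lambda>x. f (x + 1) * g x" N] f[of "- N"] f[of "N + 1"] N by simp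
  ultimately show ?thesis
    by (simp add: lap_def algebra_simps sum.distrib sum_subtractf sum_distrib_left[symmetric])
qed

section \<open>Reversibility and monotonicity of the discrete kernel\<close>

locale traps =
  fixes \<tau> :: "int \<Rightarrow> real"
  assumes tau_ge_1: "\<And>x. 1 \<le> \<tau> x"
begin

lemma tau_pos [simp]: "0 < \<tau> x" "\<tau> x \<noteq> 0" "0 \<le> \<tau> x"
  using tau_ge_1[of x] by auto

abbreviation "h \<equiv> disc_kernel \<tau>"

lemma disc_kernel_Suc_tau: "\<tau> x * h (Suc n) x = \<tau> x * h n x + lap (h n) x / 4"
  by (simp add: disc_kernel.simps field_simps)

text \<open>Densities with respect to \<tau> evolve by \<open>Q\<close> acting on functions, so each
  new value is a convex combination of three old ones.\<close>

lemma disc_kernel_bounds: "0 \<le> h n x \<and> h n x \<le> 1"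
proof (induction n arbitrary: x)
  case 0
  then show ?case using tau_ge_1[of 0] by (simp add: divide_simps)
next
  case (Suc n)
  let ?c = "1 / (4 * \<tau> x)"
  have c: "0 \<le> ?c" "?c \<le> 1/4" using tau_ge_1[of x] by (simp_all add: divide_simps)
  have eq: "h (Suc n) x = (1 - 2 * ?c) * h n x + ?c * (h n (x-1) + h n (x+1))"
    by (simp add: disc_kernel.simps lap_def field_simps)
  have "(1 - 2 * ?c) * h n x \<le> (1 - 2 * ?c) * 1"
    using c Suc.IH[of x] by (intro mult_left_mono) auto
  moreover have "?c * (h n (x-1) + h n (x+1)) \<le> ?c * 2"
    using c Suc.IH[of "x-1"] Suc.IH[of "x+1"] by (intro mult_left_mono) auto
  moreover have "0 \<le> (1 - 2 * ?c) * h n x" "0 \<le> ?c * (h n (x-1) + h n (x+1))"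
    using c Suc.IH[of x] Suc.IH[of "x-1"] Suc.IH[of "x+1"] by (auto intro!: mult_nonneg_nonneg)
  moreover have "(1 - 2 * ?c) * 1 + ?c * 2 = 1" by simp
  ultimately show ?case unfolding eq by linarith
qed

lemmas disc_kernel_nonneg = disc_kernel_bounds[THEN conjunct1]

text \<open>Self-adjointness of \<open>Q\<close> in the space weighted by \<tau>; the window
  contains both supports with a margin.\<close>

lemma disc_kernel_move:
  assumes "int (Suc m) < N" "int (Suc n) < N"
  shows "(\<Sum>x=-N..N. \<tau> x * h (Suc m) x * h n x) = (\<Sum>x=-N..N. \<tau> x * h m x * h (Suc n) x)"
proof -
  have "(\<Sum>x=-N..N. lap (h m) x * h n x) = (\<Sum>x=-N..N. h m x * lap (h n) x)"
    using assms by (intro sum_lap_commute[symmetric] disc_kernel_outside) auto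
  then have "(\<Sum>x=-N..N. (\<tau> x * h m x + lap (h m) x / 4) * h n x)
      = (\<Sum>x=-N..N. h m x * (\<tau> x * h n x + lap (h n) x / 4))"
    by (simp add: algebra_simps sum.distrib flip: sum_divide_distrib)
  then show ?thesis
    by (simp only: disc_kernel_Suc_tau[symmetric]) (simp add: mult_ac)
qed

text \<open>Steps are moved one at a time from the left factor to the right one, until the left
  factor is the point mass at 0. The case \<open>m = n\<close> turns the return kernel into a
  squared norm.\<close>

lemma disc_kernel_semigroup:
  assumes "int (m + n) < N"
  shows "(\<Sum>x=-N..N. \<tau> x * h m x * h n x) = h (m + n) 0"
  using assms
proof (induction m arbitrary: n)
  case 0
  have "(\<Sum>x=-N..N. \<tau> x * h 0 x * h n x) = (\<Sum>x=-N..N. if x = 0 then h n x else 0)"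
    by (intro sum.cong) auto
  then show ?case using 0 by simp
next
  case (Suc m)
  then show ?case using disc_kernel_move[of m N n] Suc.IH[of "Suc n"] by simp
qed

lemma disc_kernel_mass:
  assumes "int n < N"
  shows "(\<Sum>x=-N..N. \<tau> x * h n x) = 1"
  using assms
proof (induction n)
  case 0
  have "(\<Sum>x=-N..N. \<tau> x * h 0 x) = (\<Sum>x=-N..N. if x = 0 then 1 else 0)"
    by (intro sum.cong) auto
  then show ?case using 0 by simp
next
  case (Suc n)
  have "(\<Sum>x=-N..N. h n x * lap (\<lambda>_. 1) x) = (\<Sum>x=-N..N. lap (h n) x * 1)"
    using Suc.prems by (intro sum_lap_commute disc_kernel_outside) auto
  then have "(\<Sum>x=-N..N. lap (h n) x) = 0" by (simp add: lap_def)
  then show ?case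
    using Suc unfolding disc_kernel_Suc_tau sum.distrib
    by (simp flip: sum_divide_distrib)
qed

text \<open>Write \<open>Q = (I + R) / 2\<close>; as \<open>\<tau> \<ge> 1\<close>, \<open>R\<close> is a reversible stochastic matrix and hence a
  contraction of \<open>\<ell>\<^sup>2(\<tau>)\<close>.\<close>

lemma R_contraction:
  defines "R \<equiv> \<lambda>n x. h n x + lap (h n) x / (2 * \<tau> x)"
  assumes N: "int n + 1 < N"
  shows "(\<Sum>x=-N..N. \<tau> x * (R n x)\<^sup>2) \<le> (\<Sum>x=-N..N. \<tau> x * (h n x)\<^sup>2)"
proof -
  have pt: "\<tau> x * (R n x)\<^sup>2 \<le> \<tau> x * (h n x)\<^sup>2 + lap (\<lambda>y. (h n y)\<^sup>2) x / 2" for x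
  proof -
    let ?c = "1 / (2 * \<tau> x)"
    have c: "0 \<le> ?c" "?c \<le> 1/2" using tau_ge_1[of x] by (simp_all add: divide_simps)
    let ?a = "h n x" and ?b = "h n (x-1)" and ?d = "h n (x+1)"
    \<comment> \<open>The variance of \<open>a\<close>, \<open>b\<close>, \<open>d\<close> under the
      weights \<open>1 - 2*c\<close>, \<open>c\<close>, \<open>c\<close>, written through pairwise
      differences. It is nonnegative because \<open>c \<le> 1/2\<close>, that is \<tau> \<ge>
      1.\<close>
    have id: "(1 - 2*c) * a\<^sup>2 + c * b\<^sup>2 + c * d\<^sup>2 - ((1 - 2*c) * a + c * b + c * d)\<^sup>2
        = (1 - 2*c) * c * (a - b)\<^sup>2 + (1 - 2*c) * c * (a - d)\<^sup>2 + c * c * (b - d)\<^sup>2"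
      for a b c d :: real
      by algebra
    note id[of ?c ?a ?b ?d]
    moreover have "(1 - 2*?c) * ?c * (?a - ?b)\<^sup>2 + (1 - 2*?c) * ?c * (?a - ?d)\<^sup>2 + ?c * ?c * (?b - ?d)\<^sup>2 \<ge> 0"
      using c by (intro add_nonneg_nonneg mult_nonneg_nonneg) auto
    ultimately have "((1 - 2*?c) * ?a + ?c * ?b + ?c * ?d)\<^sup>2 \<le> (1 - 2*?c) * ?a\<^sup>2 + ?c * ?b\<^sup>2 + ?c * ?d\<^sup>2"
      by linarith
    moreover have "R n x = (1 - 2*?c) * ?a + ?c * ?b + ?c * ?d"
      by (simp add: R_def lap_def field_simps)
    ultimately have "\<tau> x * (R n x)\<^sup>2 \<le> \<tau> x * ((1 - 2*?c) * ?a\<^sup>2 + ?c * ?b\<^sup>2 + ?c * ?d\<^sup>2)"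
      by (intro mult_left_mono) auto
    also have "\<dots> = \<tau> x * ?a\<^sup>2 + (?b\<^sup>2 + ?d\<^sup>2 - 2 * ?a\<^sup>2) / 2"
      by (simp add: field_simps)
    finally show ?thesis by (simp add: lap_def)
  qed
  have "(\<Sum>x=-N..N. (h n x)\<^sup>2 * lap (\<lambda>_. 1) x) = (\<Sum>x=-N..N. lap (\<lambda>y. (h n y)\<^sup>2) x * 1)"
    using N by (intro sum_lap_commute) (auto simp: disc_kernel_outside)
  then have "(\<Sum>x=-N..N. lap (\<lambda>y. (h n y)\<^sup>2) x) = 0" by (simp add: lap_def)
  moreover have "(\<Sum>x=-N..N. \<tau> x * (R n x)\<^sup>2)
      \<le> (\<Sum>x=-N..N. \<tau> x * (h n x)\<^sup>2 + lap (\<lambda>y. (h n y)\<^sup>2) x / 2)"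
    by (intro sum_mono pt)
  ultimately show ?thesis
    by (simp add: sum.distrib flip: sum_divide_distrib)
qed

text \<open>With \<open>f = h m\<close> and \<open>Q = (I + R) / 2\<close>, an even index asks for
  \<open><f, Q f> \<le> <f, f>\<close> and an odd one for \<open><Q f, Q f> \<le> <f, Q f>\<close>.
  The second reduces to the contraction property of \<open>R\<close>, the first to that and
  \<open>2 <f, R f> \<le> <f, f> + <R f, R f>\<close>.\<close>

lemma disc_kernel_decreasing_step: "h (Suc n) 0 \<le> h n 0"
proof -
  define N :: int where "N = int n + 5"
  obtain m where m: "n = 2 * m \<or> n = Suc (2 * m)"
    by (metis evenE oddE Suc_eq_plus1)
  define S where "S f g = (\<Sum>x=-N..N. \<tau> x * f x * g x)" for f g :: "int \<Rightarrow> real"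
  define R where "R x = h m x + lap (h m) x / (2 * \<tau> x)" for x
  have hSuc: "h (Suc m) x = (h m x + R x) / 2" for x
    by (simp add: disc_kernel.simps R_def field_simps)
  have sg: "S (h i) (h j) = h (i + j) 0" if "i + j \<le> n + 2" for i j
    unfolding S_def using that by (intro disc_kernel_semigroup) (simp add: N_def)
  have bil: "S (h m) (h (Suc m)) = (S (h m) (h m) + S (h m) R) / 2"
    "S (h (Suc m)) (h (Suc m)) = (S (h m) (h m) + 2 * S (h m) R + S R R) / 4"
    unfolding S_def hSuc sum_distrib_left sum_divide_distrib sum.distrib[symmetric]
    by (rule sum.cong[OF refl], simp add: field_simps)+
  have c: "S R R \<le> S (h m) (h m)"
  proof -
    have "int m + 1 < N" using m by (auto simp: N_def)
    from R_contraction[OF this] show ?thesis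
      unfolding S_def R_def power2_eq_square mult.assoc[symmetric] .
  qed
  have "0 \<le> (\<Sum>x=-N..N. \<tau> x * (h m x - R x)\<^sup>2)" by (intro sum_nonneg) auto
  also have "\<dots> = S (h m) (h m) + S R R - 2 * S (h m) R"
    unfolding S_def sum_distrib_left sum.distrib[symmetric] sum_subtractf[symmetric]
    by (rule sum.cong[OF refl]) (simp add: power2_eq_square algebra_simps)
  finally have d: "2 * S (h m) R \<le> S (h m) (h m) + S R R" by simp
  have steps: "S (h m) (h (Suc m)) \<le> S (h m) (h m)"
      "S (h (Suc m)) (h (Suc m)) \<le> S (h m) (h (Suc m))"
    unfolding bil using c d by argo+
  from m show ?thesis
  proof
    assume n: "n = 2 * m"
    have "S (h m) (h m) = h n 0" "S (h m) (h (Suc m)) = h (Suc n) 0"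
      using sg[of m m] sg[of m "Suc m"] n by (simp_all add: mult_2)
    with steps(1) show ?thesis by (simp only:)
  next
    assume n: "n = Suc (2 * m)"
    have "S (h m) (h (Suc m)) = h n 0" "S (h (Suc m)) (h (Suc m)) = h (Suc n) 0"
      using sg[of m "Suc m"] sg[of "Suc m" "Suc m"] n by (simp_all add: mult_2)
    with steps(2) show ?thesis by (simp only:)
  qed
qed

lemma disc_kernel_antimono: "m \<le> n \<Longrightarrow> h n 0 \<le> h m 0"
  using lift_Suc_antimono_le[of "\<lambda>n. h n 0" m n] disc_kernel_decreasing_step by blast

section \<open>Green function bounds for the discrete kernel\<close>

abbreviation "G \<equiv> green \<tau>"

text \<open>The recursion telescopes to \<open>h n - h 0\<close>. Hence \<open>G n\<close> is convex
  away from the origin and has a kink of slope change at least -4 there.\<close>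

lemma lap_green: "lap (G n) x = 4 * (\<tau> x * h n x - (if x = 0 then 1 else 0))"
proof (induction n)
  case (Suc n)
  have "lap (G (Suc n)) x = lap (G n) x + lap (h n) x"
    by (simp add: green_def lap_def)
  then show ?case unfolding Suc disc_kernel_Suc_tau by simp
qed (auto simp: green_def lap_def)

text \<open>Coming from the left, where \<open>G n\<close> vanishes, convexity makes it
  nondecreasing up to 0. The kink then allows a descent of slope at most 4, and convexity on the
  right can only flatten it.\<close>

lemma green_drop:
  "G n 0 - G n (int y) \<le> 4 * real y"
proof -
  have out: "G n x = 0" if "int n < \<bar>x\<bar>" for x
    using that by (auto simp: green_def intro!: sum.neutral disc_kernel_outside)
  have lap0: "0 \<le> lap (G n) x" if "x \<noteq> 0" for x
    using that disc_kernel_nonneg by (simp add: lap_green)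
  \<comment> \<open>Induction inwards from beyond the support, where both values are 0.\<close>
  have left: "0 \<le> G n (- int k) - G n (- int k - 1)" for k
  proof (induction "Suc n - k" arbitrary: k)
    case 0
    then show ?case using out[of "- int k"] out[of "- int k - 1"] by auto
  next
    case (Suc d)
    from Suc.hyps(1)[of "Suc k"] Suc.hyps(2)
    have "0 \<le> G n (- int (Suc k)) - G n (- int (Suc k) - 1)" by auto
    moreover have "- int (Suc k) = - int k - 1" "- int (Suc k) - 1 = - int k - 1 - 1" by simp_all
    ultimately have "0 \<le> G n (- int k - 1) - G n (- int k - 1 - 1)" by (simp only:)
    moreover have "0 \<le> lap (G n) (- int k - 1)" by (rule lap0) auto
    ultimately show ?case by (simp add: lap_def)
  qed
  have "lap (G n) 0 \<ge> - 4" using disc_kernel_nonneg[of n 0] by (simp add: lap_green)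
  with left[of 0] have base: "G n 0 - G n 1 \<le> 4" by (simp add: lap_def)
  have slope: "G n (int k) - G n (int k + 1) \<le> 4" for k
  proof (induction k)
    case (Suc k)
    have "0 \<le> lap (G n) (int (Suc k))" by (rule lap0) auto
    then show ?case using Suc by (simp add: lap_def algebra_simps)
  qed (use base in simp)
  show ?thesis
  proof (induction y)
    case (Suc y)
    then show ?case using slope[of y] by (simp add: algebra_simps)
  qed simp
qed

text \<open>Average \<open>green_drop\<close> over \<open>[0, r]\<close> with weights \<tau>: each
  of the \<open>n\<close> summands of \<open>G n\<close> has total mass 1, so the weighted average
  of \<open>G n\<close> is at most \<open>n / V\<close>.\<close>

lemma green_upper:
  "G n 0 \<le> real n / (\<Sum>x=0..int r. \<tau> x) + 4 * real r"
proof -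
  define V where "V = (\<Sum>x=0..int r. \<tau> x)"
  have V: "0 < V" unfolding V_def by (intro sum_pos) auto
  define N where "N = int n + int r + 1"
  have G0: "0 \<le> G n x" for x using disc_kernel_nonneg by (simp add: green_def sum_nonneg)
  have "(\<Sum>x=0..int r. \<tau> x * G n x) \<le> (\<Sum>x=-N..N. \<tau> x * G n x)"
    using G0 by (intro sum_mono2) (auto simp: N_def)
  also have "\<dots> = (\<Sum>k<n. \<Sum>x=-N..N. \<tau> x * h k x)"
    unfolding green_def sum_distrib_left by (rule sum.swap)
  also have "\<dots> = (\<Sum>k<n. 1)"
    by (intro sum.cong disc_kernel_mass) (auto simp: N_def)
  finally have m: "(\<Sum>x=0..int r. \<tau> x * G n x) \<le> real n" by simp
  have "G n 0 * V = (\<Sum>x=0..int r. \<tau> x * G n 0)"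
    by (simp add: V_def sum_distrib_left mult_ac)
  also have "\<dots> \<le> (\<Sum>x=0..int r. \<tau> x * G n x + \<tau> x * (4 * real r))"
  proof (rule sum_mono)
    fix x assume x: "x \<in> {0..int r}"
    have "G n 0 \<le> G n x + 4 * real r"
      using green_drop[of n "nat x"] x by simp
    then show "\<tau> x * G n 0 \<le> \<tau> x * G n x + \<tau> x * (4 * real r)"
      by (simp add: mult_left_mono flip: distrib_left)
  qed
  also have "\<dots> \<le> real n + V * (4 * real r)"
    using m by (simp add: sum.distrib V_def sum_distrib_right)
  finally show ?thesis using V unfolding V_def[symmetric] by (simp add: field_simps)
qed

lemma disc_kernel_upper:
  "h n 0 \<le> 1 / (\<Sum>x=0..int r. \<tau> x) + 4 * real r / real (Suc n)"
proof -
  have "real (Suc n) * h n 0 = (\<Sum>k<Suc n. h n 0)" by simp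
  also have "\<dots> \<le> G (Suc n) 0"
    unfolding green_def by (intro sum_mono disc_kernel_antimono) auto
  also note green_upper[of "Suc n" r]
  finally show ?thesis by (simp add: field_simps)
qed

lemma disc_kernel_lower:
  fixes R :: nat
  assumes "0 < R" "G n 0 \<le> R"
  shows "1 / (4 * (\<Sum>x=-int R..int R. \<tau> x)) \<le> h (2 * n) 0"
proof -
  define V where "V = (\<Sum>x=-int R..int R. \<tau> x)"
  have V: "0 < V" unfolding V_def by (intro sum_pos) auto
  define g where "g x = max 0 (1 - \<bar>real_of_int x\<bar> / R)" for x :: int
  define N where "N = 2 * int n + int R + 1"
  \<comment> \<open>The tent is concave only at its tip, where the slope changes by
    \<open>2 / R\<close>; at its feet it is convex.\<close>
  have lapg: "lap g x \<ge> (if x = 0 then - 2 / R else 0)" for x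
  proof -
    have c: "max 0 (1 - (a - 1) / R) + max 0 (1 - (a + 1) / R) \<ge> 2 * max 0 (1 - a / R)" for a :: real
    proof -
      have "1 - (a - 1) / R = 1 - a / R + 1 / R" "1 - (a + 1) / R = 1 - a / R - 1 / R"
        by (simp_all add: diff_divide_distrib add_divide_distrib)
      then show ?thesis by (smt (verit))
    qed
    consider "x = 0" | "x \<ge> 1" | "x \<le> - 1" by linarith
    then show ?thesis
    proof cases
      case 1 then show ?thesis using assms(1) by (auto simp: lap_def g_def max_def field_simps)
    next
      case 2 then show ?thesis using c[of "real_of_int x"] by (simp add: lap_def g_def)
    next
      case 3 
      then have "\<bar>real_of_int x - 1\<bar> = - real_of_int x + 1" "\<bar>real_of_int x + 1\<bar> = - real_of_int x - 1"
        by linarith+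
      with 3 show ?thesis using c[of "- real_of_int x"] by (simp add: lap_def g_def)
    qed
  qed
  \<comment> \<open>By summation by parts, step \<open>k\<close> costs at most
    \<open>h k 0 / (2 * R)\<close>, and these losses add up to the local time at the tip.\<close>
  have "1 - G k 0 / (2 * R) \<le> (\<Sum>x=-N..N. \<tau> x * h k x * g x)" if "k \<le> n" for k
    using that
  proof (induction k)
    case 0
    have "(\<Sum>x=-N..N. \<tau> x * h 0 x * g x) = (\<Sum>x=-N..N. if x = 0 then 1 else 0)"
      by (intro sum.cong) (auto simp: g_def)
    then show ?case by (simp add: green_def N_def)
  next
    case (Suc k)
    have "(\<Sum>x=-N..N. lap (h k) x * g x) = (\<Sum>x=-N..N. h k x * lap g x)"
      using Suc.prems by (intro sum_lap_commute[symmetric] disc_kernel_outside) (auto simp: N_def)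
    also have "\<dots> \<ge> (\<Sum>x=-N..N. h k x * (if x = 0 then - 2 / R else 0))"
      using disc_kernel_nonneg by (intro sum_mono mult_left_mono lapg) 
    also have "(\<Sum>x=-N..N. h k x * (if x = 0 then - 2 / R else 0))
        = (\<Sum>x=-N..N. if x = 0 then - 2 * h k 0 / R else 0)"
      by (intro sum.cong) auto
    also have "\<dots> = - 2 * h k 0 / R" by (simp add: N_def)
    finally have "(\<Sum>x=-N..N. lap (h k) x * g x) / 4 \<ge> - h k 0 / (2 * R)" by simp
    moreover have "(\<Sum>x=-N..N. \<tau> x * h (Suc k) x * g x)
        = (\<Sum>x=-N..N. \<tau> x * h k x * g x) + (\<Sum>x=-N..N. lap (h k) x * g x) / 4"
      unfolding disc_kernel_Suc_tau
      by (simp add: algebra_simps sum.distrib flip: sum_divide_distrib)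
    moreover have "G (Suc k) 0 = G k 0 + h k 0" by (simp add: green_def)
    ultimately show ?case using Suc assms(1) by (simp add: add_divide_distrib)
  qed
  from this[of n] have "1 - G n 0 / (2 * R) \<le> (\<Sum>x=-N..N. \<tau> x * h n x * g x)" by simp
  moreover have "G n 0 / (2 * R) \<le> 1 / 2" using assms by (simp add: field_simps)
  ultimately have "1 / 2 \<le> (\<Sum>x=-N..N. \<tau> x * h n x * g x)" by linarith
  also have "\<dots> = (\<Sum>x=-int R..int R. \<tau> x * h n x * g x)"
    using assms(1) by (intro sum.mono_neutral_right) (auto simp: N_def g_def field_simps)
  also have "\<dots> \<le> (\<Sum>x=-int R..int R. \<tau> x * h n x * 1)"
    using disc_kernel_nonneg by (intro sum_mono mult_left_mono) (auto simp: g_def)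
  \<comment> \<open>Splitting \<tau> into two square roots prepares Cauchy-Schwarz: one factor
    becomes the trap mass, the other the squared norm of \<open>h n\<close>, which is
    \<open>h (2 * n) 0\<close>.\<close>
  finally have "1 / 2 \<le> (\<Sum>x=-int R..int R. sqrt (\<tau> x) * (sqrt (\<tau> x) * h n x))"
    by (simp flip: mult.assoc)
  then have "(1 / 2)\<^sup>2 \<le> (\<Sum>x=-int R..int R. sqrt (\<tau> x) * (sqrt (\<tau> x) * h n x))\<^sup>2"
    by (intro power_mono) auto
  also have "\<dots> \<le> (\<Sum>x=-int R..int R. (sqrt (\<tau> x))\<^sup>2) * (\<Sum>x=-int R..int R. (sqrt (\<tau> x) * h n x)\<^sup>2)"
    by (rule Cauchy_Schwarz_ineq_sum)
  also have "\<dots> = V * (\<Sum>x=-int R..int R. \<tau> x * h n x * h n x)"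
  proof -
    have "(sqrt (\<tau> x) * h n x)\<^sup>2 = \<tau> x * h n x * h n x" for x
      by (simp add: power_mult_distrib) (simp add: power2_eq_square)
    then show ?thesis by (simp add: V_def)
  qed
  also have "\<dots> \<le> V * (\<Sum>x=-N..N. \<tau> x * h n x * h n x)"
    using V disc_kernel_nonneg by (intro mult_left_mono sum_mono2) (auto simp: N_def)
  also have "\<dots> = V * h (2 * n) 0"
  proof -
    have "int (n + n) < N" by (simp add: N_def)
    from disc_kernel_semigroup[OF this] show ?thesis by (simp only: mult_2)
  qed
  finally have "1 / 4 \<le> V * h (2 * n) 0" by (simp add: power2_eq_square)
  then show ?thesis using V unfolding V_def[symmetric] by (simp add: field_simps)
qed

end

section \<open>Poissonisation\<close>

text \<open>The Poisson weights of mean \<open>2 * t\<close> are arranged as a power series in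
  \<open>t\<close>, so that it can be differentiated termwise.\<close>

definition pois_kernel :: "(int \<Rightarrow> real) \<Rightarrow> real \<Rightarrow> int \<Rightarrow> real" where
  "pois_kernel \<tau> t x = exp (- 2 * t) * (\<Sum>n. (2 ^ n * disc_kernel \<tau> n x / fact n) * t ^ n)"

lemma summable_exp_terms: "summable (\<lambda>n. s ^ n / fact n :: real)"
  using summable_exp_generic[of s] by (simp add: divide_inverse mult_ac)

lemma suminf_exp_terms: "(\<Sum>n. s ^ n / fact n) = exp (s::real)"
  by (simp add: exp_def divide_inverse mult_ac)

context traps begin

abbreviation "c x n \<equiv> 2 ^ n * h n x / fact n"

lemma summable_pois: "summable (\<lambda>n. c x n * t ^ n)"
proof (rule summable_comparison_test')
  show "summable (\<lambda>n. (2 * \<bar>t\<bar>) ^ n / fact n)" by (rule summable_exp_terms)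
  show "norm (c x n * t ^ n) \<le> (2 * \<bar>t\<bar>) ^ n / fact n" if "n \<ge> 0" for n
    using disc_kernel_bounds[of n x]
    by (auto simp: abs_mult power_mult_distrib power_abs divide_simps mult_left_le_one_le mult_left_le mult_le_cancel_left1)
qed

lemma pois_kernel_0: "pois_kernel \<tau> 0 x = (if x = 0 then 1 / \<tau> 0 else 0)"
proof -
  have "(\<Sum>n. c x n * 0 ^ n) = c x 0"
    using powser_zero[of "c x"] by simp
  then show ?thesis by (simp add: pois_kernel_def)
qed

lemma pois_kernel_nonneg: "0 \<le> t \<Longrightarrow> 0 \<le> pois_kernel \<tau> t x"
  unfolding pois_kernel_def using disc_kernel_nonneg
  by (intro mult_nonneg_nonneg suminf_nonneg summable_pois) auto

lemma pois_kernel_sums: "(\<lambda>n. exp (- s) * (s ^ n / fact n) * h n x) sums pois_kernel \<tau> (s / 2) x"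
proof -
  have "(\<lambda>n. exp (- s) * (c x n * (s / 2) ^ n)) sums pois_kernel \<tau> (s / 2) x"
    unfolding pois_kernel_def using summable_sums[OF summable_pois, THEN sums_mult] by simp
  moreover have "exp (- s) * (c x n * (s / 2) ^ n) = exp (- s) * (s ^ n / fact n) * h n x" for n
    by (simp add: power_divide)
  ultimately show ?thesis by (simp only:)
qed

lemma exp_terms_sums: "(\<lambda>n. exp (- s) * (s ^ n / fact n)) sums (1::real)"
  using summable_sums[OF summable_exp_terms[of s], THEN sums_mult, of "exp (- s)"]
  by (simp add: suminf_exp_terms exp_minus_inverse mult.commute)

lemma pois_kernel_le_1:
  assumes "0 \<le> t" shows "pois_kernel \<tau> t x \<le> 1"
proof (rule sums_le[OF _ _ exp_terms_sums])
  show "(\<lambda>n. exp (- (2 * t)) * ((2 * t) ^ n / fact n) * h n x) sums pois_kernel \<tau> t x"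
    using pois_kernel_sums[of "2 * t"] by simp
  show "exp (- (2 * t)) * ((2 * t) ^ n / fact n) * h n x \<le> exp (- (2 * t)) * ((2 * t) ^ n / fact n)" for n
    using assms disc_kernel_bounds[of n x] by (intro mult_left_le) auto
qed


text \<open>Kolmogorov's equation. \<open>diffs\<close> shifts the index, the recursion turns the
  shift into \<open>2 * (I + L/2)\<close>, and the \<open>2 * I\<close> cancels against the
  derivative of \<open>exp (- 2 * t)\<close>.\<close>

lemma pois_kernel_deriv:
  "((\<lambda>t. pois_kernel \<tau> t x) has_real_derivative lap (pois_kernel \<tau> t) x / (2 * \<tau> x)) (at t)"
proof -
  let ?S = "\<lambda>x t. \<Sum>n. c x n * t ^ n"
  have "((?S x) has_real_derivative (\<Sum>n. diffs (c x) n * t ^ n)) (at t)"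
    by (rule termdiffs_strong_converges_everywhere) (rule summable_pois)
  also have "(\<lambda>n. diffs (c x) n * t ^ n) = (\<lambda>n. 2 * (c x n * t ^ n) +
      (1 / (2 * \<tau> x)) * (c (x-1) n * t ^ n + c (x+1) n * t ^ n - 2 * (c x n * t ^ n)))"
    by (simp add: fun_eq_iff diffs_def disc_kernel.simps lap_def field_simps del: of_nat_Suc)
  also have "(\<Sum>n. 2 * (c x n * t ^ n) +
      (1 / (2 * \<tau> x)) * (c (x-1) n * t ^ n + c (x+1) n * t ^ n - 2 * (c x n * t ^ n)))
     = 2 * ?S x t + (1 / (2 * \<tau> x)) * (?S (x-1) t + ?S (x+1) t - 2 * ?S x t)"
    by (intro sums_unique[symmetric] sums_add sums_mult sums_diff summable_sums summable_pois)
  finally have D: "((?S x) has_real_derivative 2 * ?S x t + (1 / (2 * \<tau> x)) * (?S (x-1) t + ?S (x+1) t - 2 * ?S x t)) (at t)" .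
  have "((\<lambda>t. exp (- 2 * t) * ?S x t) has_real_derivative
      (exp (- 2 * t) * - 2) * ?S x t + (2 * ?S x t + (1 / (2 * \<tau> x)) * (?S (x-1) t + ?S (x+1) t - 2 * ?S x t)) * exp (- 2 * t)) (at t)"
    by (intro DERIV_mult D) (auto intro!: derivative_eq_intros)
  also have "(exp (- 2 * t) * - 2) * ?S x t + (2 * ?S x t + (1 / (2 * \<tau> x)) * (?S (x-1) t + ?S (x+1) t - 2 * ?S x t)) * exp (- 2 * t)
    = lap (pois_kernel \<tau> t) x / (2 * \<tau> x)"
    by (simp add: lap_def pois_kernel_def field_simps)
  finally show ?thesis by (simp add: pois_kernel_def[abs_def])
qed

text \<open>Averages the discrete bound: if \<open>N\<close> is Poisson of mean \<open>s\<close>,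
  then \<open>1 / (N + 1)\<close> has mean \<open>(1 - exp (- s)) / s\<close>. Monotonicity is thus
  used in discrete time only.\<close>

lemma pois_kernel_upper:
  assumes "0 < t"
  shows "pois_kernel \<tau> t 0 \<le> 1 / (\<Sum>x=0..int r. \<tau> x) + 2 * real r / t"
proof -
  define s where "s = 2 * t"
  have s: "0 < s" using assms by (simp add: s_def)
  let ?p = "\<lambda>n. exp (- s) * (s ^ n / fact n)"
  define V where "V = (\<Sum>x=0..int r. \<tau> x)"
  have "(\<lambda>n. s ^ Suc n / fact (Suc n)) sums (exp s - 1)"
    using sums_Suc_iff[of "\<lambda>n. s ^ n / fact n" "exp s - 1"]
      summable_sums[OF summable_exp_terms[of s]] suminf_exp_terms[of s] by simp
  then have "(\<lambda>n. exp (- s) * (4 * real r / s) * (s ^ Suc n / fact (Suc n)))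
      sums (exp (- s) * (4 * real r / s) * (exp s - 1))" by (rule sums_mult)
  moreover have "exp (- s) * (4 * real r / s) * (s ^ Suc n / fact (Suc n)) = ?p n * (4 * real r / real (Suc n))" for n
    using s by (simp add: field_simps)
  moreover have "exp (- s) * (4 * real r / s) * (exp s - 1) = (4 * real r / s) * (1 - exp (- s))"
    by (simp add: algebra_simps flip: exp_add)
  ultimately have "(\<lambda>n. ?p n * (4 * real r / real (Suc n))) sums ((4 * real r / s) * (1 - exp (- s)))" by (simp only:)
  from sums_add[OF sums_mult2[OF exp_terms_sums[of s], of "1 / V"] this]
  have "(\<lambda>n. ?p n * (1 / V + 4 * real r / real (Suc n))) sums (1 / V + (4 * real r / s) * (1 - exp (- s)))"
    by (simp only: distrib_left mult_1)
  note upper = this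
  have "pois_kernel \<tau> (s / 2) 0 \<le> 1 / V + (4 * real r / s) * (1 - exp (- s))"
  proof (rule sums_le[OF _ pois_kernel_sums[of s 0] upper])
    show "?p n * h n 0 \<le> ?p n * (1 / V + 4 * real r / real (Suc n))" for n
      using s disc_kernel_upper[of n r] unfolding V_def by (intro mult_left_mono) auto
  qed
  also have "\<dots> \<le> 1 / V + (4 * real r / s) * 1"
    using s by (intro add_left_mono mult_left_mono) auto
  finally show ?thesis by (simp add: s_def V_def)
qed

text \<open>Markov's inequality in disguise: by monotonicity \<open>h k 0\<close> is at least
  \<open>h (2 * n) 0 * (1 - k / (2 * n))\<close> for every \<open>k\<close>, and this linear
  minorant has an explicit Poisson mean, at least half of \<open>h (2 * n) 0\<close> because
  \<open>s \<le> n\<close>.\<close>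

lemma pois_kernel_lower:
  fixes R n r :: nat
  assumes t: "0 < t" "2 * t \<le> real n"
    and R: "0 < R" "real n / (\<Sum>x=0..int r. \<tau> x) + 4 * real r \<le> real R"
  shows "1 / (8 * (\<Sum>x=-int R..int R. \<tau> x)) \<le> pois_kernel \<tau> t 0"
proof -
  define s where "s = 2 * t"
  have s: "0 < s" "s \<le> n" using t by (auto simp: s_def)
  let ?p = "\<lambda>n. exp (- s) * (s ^ n / fact n)"
  let ?H = "h (2 * n) 0"
  have n: "0 < real n" using s by linarith
  have "(\<lambda>k. real (Suc k) * ?p (Suc k)) sums s"
    using sums_mult[OF exp_terms_sums[of s], of s] by (simp add: field_simps del: of_nat_Suc)
  then have "(\<lambda>k. real k * ?p k) sums s"
    using sums_Suc_iff[of "\<lambda>k. real k * ?p k" s] by simp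
  from sums_diff[OF exp_terms_sums[of s] sums_divide[OF this, of "real (2 * n)"], THEN sums_mult2, of ?H]
  have "(\<lambda>k. ?p k * (?H * (1 - real k / real (2 * n)))) sums ((1 - s / real (2 * n)) * ?H)"
    by (simp add: algebra_simps)
  moreover have "?p k * (?H * (1 - real k / real (2 * n))) \<le> ?p k * h k 0" for k
  proof (rule mult_left_mono)
    show "?H * (1 - real k / real (2 * n)) \<le> h k 0"
    proof (cases "k \<le> 2 * n")
      case True
      have "?H * (1 - real k / real (2 * n)) \<le> ?H * 1"
        using n disc_kernel_nonneg by (intro mult_left_mono) auto
      also have "\<dots> \<le> h k 0" using True disc_kernel_antimono by simp
      finally show ?thesis .
    next
      case False
      then have "1 - real k / real (2 * n) \<le> 0" using n by (simp add: field_simps)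
      then have "?H * (1 - real k / real (2 * n)) \<le> 0"
        using disc_kernel_nonneg by (simp add: mult_nonneg_nonpos)
      then show ?thesis using disc_kernel_nonneg[of k 0] by linarith
    qed
  qed (use s in auto)
  ultimately have "(1 - s / real (2 * n)) * ?H \<le> pois_kernel \<tau> (s / 2) 0"
    by (rule sums_le[OF _ _ pois_kernel_sums[of s 0], rotated])
  moreover have "1 / 2 \<le> 1 - s / real (2 * n)" using s n by (simp add: field_simps)
  then have "1 / 2 * ?H \<le> (1 - s / real (2 * n)) * ?H"
    using disc_kernel_nonneg by (intro mult_right_mono)
  moreover have "1 / (4 * (\<Sum>x=-int R..int R. \<tau> x)) \<le> ?H"
    using green_upper[of n r] R by (intro disc_kernel_lower) auto
  ultimately show ?thesis by (simp add: s_def)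
qed

end

section \<open>Identification with the jump chain and its holding times\<close>

abbreviation "exp_law m \<equiv> density lborel (exponential_density (1 / m))"

text \<open>Indexed by the sequence \<open>m\<close> of mean holding times instead of a path, so
  that removing the first site is a shift of \<open>m\<close>.\<close>

definition hold_mass :: "nat \<Rightarrow> (nat \<Rightarrow> real) \<Rightarrow> real \<Rightarrow> ennreal" where
  "hold_mass n m t = (\<integral>\<^sup>+e. (if (\<Sum>i<n. e i) \<le> t \<and> t < (\<Sum>i<Suc n. e i) then 1 else 0)
     \<partial>PiM {..<Suc n} (\<lambda>i. exp_law (m i)))"

lemma product_sigma_finite_exp_law:
  assumes "\<And>i. 0 < m i" shows "product_sigma_finite (\<lambda>i::nat. exp_law (m i))"
proof
  fix i show "\<exists>A. countable A \<and> A \<subseteq> sets (exp_law (m i)) \<and> \<Union> A = space (exp_law (m i)) \<and> (\<forall>a\<in>A. emeasure (exp_law (m i)) a \<noteq> \<infinity>)"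
    using prob_space_exponential_density[of "1 / m i"] assms[of i]
    by (intro sigma_finite_measure.sigma_finite_countable prob_space_imp_sigma_finite) auto
qed

lemma hold_mass_0:
  assumes "\<And>i. 0 < m i"
  shows "hold_mass 0 m t = (if 0 \<le> t then ennreal (exp (- t / m 0)) else 0)"
proof -
  interpret product_sigma_finite "\<lambda>i::nat. exp_law (m i)"
    by (rule product_sigma_finite_exp_law) fact
  have eq: "hold_mass 0 m t = (\<integral>\<^sup>+y. (if 0 \<le> t \<and> t < y then 1 else 0) \<partial>exp_law (m 0))"
  proof -
    have "{..<Suc 0} = {0::nat}" by auto
    then show ?thesis
      unfolding hold_mass_def
      using product_nn_integral_singleton[of "\<lambda>y. if 0 \<le> t \<and> t < y then 1 else 0" 0] by simp
  qed
  show ?thesis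
  proof (cases "0 \<le> t")
    case True
    have "hold_mass 0 m t = (\<integral>\<^sup>+y. ennreal (exponential_density (1 / m 0) y) * (if 0 \<le> t \<and> t < y then 1 else 0) \<partial>lborel)"
      unfolding eq by (subst nn_integral_density) auto
    also have "\<dots> = (\<integral>\<^sup>+y. ennreal (exp (- y / m 0) / m 0) * indicator {t..} y \<partial>lborel)"
    proof (rule nn_integral_cong_AE)
      show "AE y in lborel. ennreal (exponential_density (1 / m 0) y) * (if 0 \<le> t \<and> t < y then 1 else 0)
          = ennreal (exp (- y / m 0) / m 0) * indicator {t..} y"
        using AE_lborel_singleton[of t]
        by eventually_elim (use True in \<open>auto simp: exponential_density_def indicator_def mult_ac\<close>)
    qed
    also have "\<dots> = ennreal (0 - (- exp (- t / m 0)))"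
    proof (rule nn_integral_FTC_atLeast)
      show "((\<lambda>y. - exp (- y / m 0)) has_real_derivative exp (- y / m 0) / m 0) (at y)" for y
        using assms[of 0] by (auto intro!: derivative_eq_intros)
      show "((\<lambda>y. - exp (- y / m 0)) \<longlongrightarrow> 0) at_top"
        using assms[of 0] by real_asymp
    qed (use assms[of 0] in auto)
    finally show ?thesis using True by simp
  qed (simp add: eq)
qed

text \<open>Conditions on the first holding time. The other coordinates carry the indices from 1 on
  and are renumbered from 0 by a measure-preserving map, with \<open>restrict\<close> because
  elements of the product space are extensional.\<close>

lemma hold_mass_Suc:
  assumes m: "\<And>i. 0 < m i"
  shows "hold_mass (Suc n) m t = (\<integral>\<^sup>+a. hold_mass n (\<lambda>i. m (Suc i)) (t - a) \<partial>exp_law (m 0))"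
proof -
  let ?M = "\<lambda>i. exp_law (m i)"
  interpret product_sigma_finite ?M
    by (rule product_sigma_finite_exp_law) fact
  let ?I = "{1..<Suc (Suc n)}" and ?J = "{..<Suc n}"
  have I: "{..<Suc (Suc n)} = insert 0 ?I" by auto
  define f where "f e = (if (\<Sum>i<Suc n. e i) \<le> t \<and> t < (\<Sum>i<Suc (Suc n). e i) then 1 else 0 :: ennreal)" for e :: "nat \<Rightarrow> real"
  define g where "g a e = (if (\<Sum>i<n. e i) \<le> t - a \<and> t - a < (\<Sum>i<Suc n. e i) then 1 else 0 :: ennreal)" for e :: "nat \<Rightarrow> real" and a
  have shift: "f (e(0 := a)) = g a (\<lambda>i\<in>?J. e (Suc i))" for e a
  proof -
    have "(\<Sum>i<k. (e(0 := a)) (Suc i)) = (\<Sum>i<k. (\<lambda>i\<in>?J. e (Suc i)) i)" if "k \<le> Suc n" for k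
      using that by (intro sum.cong) auto
    then show ?thesis
      unfolding f_def g_def sum.lessThan_Suc_shift[of _ n] sum.lessThan_Suc_shift[of _ "Suc n"]
      by (auto simp del: sum.lessThan_Suc simp: sum.lessThan_Suc_shift[of "e(0 := a)"])
  qed
  have gm: "g a \<in> borel_measurable (PiM ?J (\<lambda>i. ?M (Suc i)))" for a
    unfolding g_def by measurable
  have "hold_mass (Suc n) m t = (\<integral>\<^sup>+e. f e \<partial>PiM (insert 0 ?I) ?M)"
    unfolding hold_mass_def f_def I ..
  also have "\<dots> = (\<integral>\<^sup>+a. (\<integral>\<^sup>+e. f (e(0 := a)) \<partial>PiM ?I ?M) \<partial>?M 0)"
  proof (rule product_nn_integral_insert_rev)
    show "f \<in> borel_measurable (PiM (insert 0 ?I) ?M)"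
      unfolding f_def I[symmetric] by measurable
  qed auto
  also have "\<dots> = (\<integral>\<^sup>+a. hold_mass n (\<lambda>i. m (Suc i)) (t - a) \<partial>?M 0)"
  proof (rule nn_integral_cong)
    fix a
    have "(\<integral>\<^sup>+e. f (e(0 := a)) \<partial>PiM ?I ?M) = (\<integral>\<^sup>+e. g a (\<lambda>i\<in>?J. e (Suc i)) \<partial>PiM ?I ?M)"
      by (simp only: shift)
    also have "\<dots> = (\<integral>\<^sup>+e. g a e \<partial>distr (PiM ?I ?M) (PiM ?J (\<lambda>i. ?M (Suc i))) (\<lambda>e. \<lambda>i\<in>?J. e (Suc i)))"
      using gm by (subst nn_integral_distr) (auto intro!: measurable_restrict measurable_component_singleton)
    also have "distr (PiM ?I ?M) (PiM ?J (\<lambda>i. ?M (Suc i))) (\<lambda>e. \<lambda>i\<in>?J. e (Suc i)) = PiM ?J (\<lambda>i. ?M (Suc i))"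
      using m by (intro distr_PiM_reindex prob_space_exponential_density) auto
    finally show "(\<integral>\<^sup>+e. f (e(0 := a)) \<partial>PiM ?I ?M) = hold_mass n (\<lambda>i. m (Suc i)) (t - a)"
      unfolding g_def hold_mass_def .
  qed
  finally show ?thesis .
qed

lemma hold_mass_measurable:
  assumes "\<And>i. 0 < m i"
  shows "hold_mass n m \<in> borel_measurable borel"
  using assms
proof (induction n arbitrary: m)
  case 0
  then have "hold_mass 0 m = (\<lambda>t. if 0 \<le> t then ennreal (exp (- t / m 0)) else 0)"
    by (intro ext hold_mass_0)
  then show ?case by simp
next
  case (Suc n)
  then have [measurable]: "hold_mass n (\<lambda>i. m (Suc i)) \<in> borel_measurable borel" by simp
  have eq: "hold_mass (Suc n) m = (\<lambda>t. \<integral>\<^sup>+a. hold_mass n (\<lambda>i. m (Suc i)) (t - a) \<partial>exp_law (m 0))"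
    using Suc.prems by (intro ext hold_mass_Suc)
  interpret prob_space "exp_law (m 0)"
    using Suc.prems by (intro prob_space_exponential_density) auto
  show ?case unfolding eq by measurable
qed

lemma nn_paths_0: "nn_paths 0 x y = (if x = y then {[x]} else {})"
  by (auto simp: nn_paths_def length_Suc_conv)

lemma nn_paths_Suc:
  "nn_paths (Suc n) x y = Cons x ` (nn_paths n (x - 1) y \<union> nn_paths n (x + 1) y)"
proof (intro set_eqI iffI)
  fix xs assume xs: "xs \<in> nn_paths (Suc n) x y"
  then obtain zs where zs: "xs = x # zs" "length zs = Suc n"
    by (auto simp: nn_paths_def length_Suc_conv)
  have "\<bar>zs ! 0 - x\<bar> = 1" using xs zs by (auto simp: nn_paths_def dest: spec[of _ 0])
  moreover have "\<bar>zs ! Suc i - zs ! i\<bar> = 1" if "i < n" for i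
    using xs zs that by (auto simp: nn_paths_def dest: spec[of _ "Suc i"])
  moreover have "zs ! n = y" using xs zs by (auto simp: nn_paths_def)
  ultimately have "zs \<in> nn_paths n (x - 1) y \<union> nn_paths n (x + 1) y"
    using zs by (auto simp: nn_paths_def)
  with zs show "xs \<in> Cons x ` (nn_paths n (x - 1) y \<union> nn_paths n (x + 1) y)" by auto
next
  fix xs assume "xs \<in> Cons x ` (nn_paths n (x - 1) y \<union> nn_paths n (x + 1) y)"
  then show "xs \<in> nn_paths (Suc n) x y"
    by (auto simp: nn_paths_def nth_Cons split: nat.splits)
qed

lemma finite_nn_paths: "finite (nn_paths n x y)"
  by (induction n arbitrary: x) (auto simp: nn_paths_0 nn_paths_Suc)

text \<open>The end is fixed at 0 and the start varies, since decomposing at the first jump moves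
  the start. Values in \<open>ennreal\<close> spare all integrability questions.\<close>

definition path_mass :: "(int \<Rightarrow> real) \<Rightarrow> nat \<Rightarrow> int \<Rightarrow> real \<Rightarrow> ennreal" where
  "path_mass \<tau> n x t = (\<Sum>xs\<in>nn_paths n x 0. ennreal ((1/2) ^ n) * hold_mass n (\<lambda>i. \<tau> (xs ! i)) t)"

context traps begin

lemma prob_space_exp_law: "prob_space (exp_law (\<tau> x))"
  by (rule prob_space_exponential_density) auto

lemma hold_prob_eq:
  assumes "length xs = Suc n"
  shows "ennreal (hold_prob \<tau> xs t) = hold_mass n (\<lambda>i. \<tau> (xs ! i)) t"
proof -
  let ?P = "PiM {..<Suc n} (\<lambda>i. exp_law (\<tau> (xs ! i)))"
  let ?A = "{e \<in> space ?P. (\<Sum>i<n. e i) \<le> t \<and> t < (\<Sum>i<Suc n. e i)}"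
  interpret prob_space ?P by (intro prob_space_PiM prob_space_exp_law)
  have [measurable]: "?A \<in> sets ?P" by measurable
  have "hold_mass n (\<lambda>i. \<tau> (xs ! i)) t = (\<integral>\<^sup>+e. indicator ?A e \<partial>?P)"
    unfolding hold_mass_def by (intro nn_integral_cong) (auto simp: indicator_def)
  also have "\<dots> = emeasure ?P ?A" by simp
  finally show ?thesis
    using assms by (simp add: hold_prob_def holding_law_def emeasure_eq_measure del: sum.lessThan_Suc)
qed

lemma path_mass_eq:
  "path_mass \<tau> n x t = ennreal (\<Sum>xs\<in>nn_paths n x 0. (1/2) ^ n * hold_prob \<tau> xs t)"
proof -
  have "path_mass \<tau> n x t = (\<Sum>xs\<in>nn_paths n x 0. ennreal ((1/2) ^ n * hold_prob \<tau> xs t))"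
    unfolding path_mass_def
  proof (rule sum.cong[OF refl])
    fix xs assume "xs \<in> nn_paths n x 0"
    then have "length xs = Suc n" by (simp add: nn_paths_def)
    then show "ennreal ((1/2) ^ n) * hold_mass n (\<lambda>i. \<tau> (xs ! i)) t = ennreal ((1/2) ^ n * hold_prob \<tau> xs t)"
      by (subst hold_prob_eq[symmetric]) (auto simp: ennreal_mult' hold_prob_def)
  qed
  also have "\<dots> = ennreal (\<Sum>xs\<in>nn_paths n x 0. (1/2) ^ n * hold_prob \<tau> xs t)"
    by (rule sum_ennreal) (auto simp: hold_prob_def)
  finally show ?thesis .
qed

lemma path_mass_measurable [measurable]: "path_mass \<tau> n x \<in> borel_measurable borel"
  unfolding path_mass_def[abs_def]
  using hold_mass_measurable[of "\<lambda>i. \<tau> (_ ! i)" n] by (intro borel_measurable_sum) simp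

lemma path_mass_0: "path_mass \<tau> 0 x t = (if x = 0 \<and> 0 \<le> t then ennreal (exp (- t / \<tau> 0)) else 0)"
  by (simp add: path_mass_def nn_paths_0 hold_mass_0)

section \<open>The renewal equation and its iteration\<close>

definition jump_op :: "(int \<Rightarrow> real \<Rightarrow> ennreal) \<Rightarrow> int \<Rightarrow> real \<Rightarrow> ennreal" where
  "jump_op f x t = (\<integral>\<^sup>+a. ennreal (1/2) * (f (x - 1) (t - a) + f (x + 1) (t - a)) \<partial>exp_law (\<tau> x))"

lemma path_mass_Suc: "path_mass \<tau> (Suc n) x t = jump_op (path_mass \<tau> n) x t"
proof -
  note [measurable] = hold_mass_measurable[of "\<lambda>i. \<tau> (_ ! i)" n, simplified]
  let ?w = "ennreal ((1/2) ^ n)" and ?h = "\<lambda>xs. hold_mass n (\<lambda>i. \<tau> (xs ! i))"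
  have disj: "nn_paths n (x - 1) 0 \<inter> nn_paths n (x + 1) 0 = {}"
    by (auto simp: nn_paths_def)
  have "path_mass \<tau> (Suc n) x t
      = (\<Sum>zs\<in>nn_paths n (x - 1) 0 \<union> nn_paths n (x + 1) 0.
          ennreal ((1/2) ^ Suc n) * hold_mass (Suc n) (\<lambda>i. \<tau> ((x # zs) ! i)) t)"
    unfolding path_mass_def nn_paths_Suc by (subst sum.reindex) auto
  also have "\<dots> = (\<Sum>zs\<in>nn_paths n (x - 1) 0 \<union> nn_paths n (x + 1) 0.
          \<integral>\<^sup>+a. ennreal (1/2) * (?w * ?h zs (t - a)) \<partial>exp_law (\<tau> x))"
  proof (rule sum.cong[OF refl])
    fix zs
    have "ennreal ((1/2) ^ Suc n) = ennreal (1/2) * ?w"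
      by (subst ennreal_mult'[symmetric]) auto
    then show "ennreal ((1/2) ^ Suc n) * hold_mass (Suc n) (\<lambda>i. \<tau> ((x # zs) ! i)) t
        = (\<integral>\<^sup>+a. ennreal (1/2) * (?w * ?h zs (t - a)) \<partial>exp_law (\<tau> x))"
      by (simp add: hold_mass_Suc nn_integral_cmult mult.assoc)
  qed
  also have "\<dots> = (\<integral>\<^sup>+a. (\<Sum>zs\<in>nn_paths n (x - 1) 0 \<union> nn_paths n (x + 1) 0.
          ennreal (1/2) * (?w * ?h zs (t - a))) \<partial>exp_law (\<tau> x))"
    by (rule nn_integral_sum[symmetric]) simp
  also have "\<dots> = jump_op (path_mass \<tau> n) x t"
    unfolding jump_op_def path_mass_def
    by (simp add: sum.union_disjoint finite_nn_paths disj sum_distrib_left distrib_left)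
  finally show ?thesis .
qed

text \<open>By symmetry of the heat kernel this is the candidate for the probability of being at 0
  at time \<open>t\<close> when started from \<open>x\<close>. Being 0 at negative times, it lets
  \<open>jump_op\<close> integrate over all holding times.\<close>

definition kern :: "int \<Rightarrow> real \<Rightarrow> ennreal" where
  "kern x t = (if 0 \<le> t then ennreal (\<tau> 0 * pois_kernel \<tau> t x) else 0)"

lemma pois_kernel_measurable [measurable]: "(\<lambda>t. pois_kernel \<tau> t x) \<in> borel_measurable borel"
proof (rule borel_measurable_continuous_onI)
  show "continuous_on UNIV (\<lambda>t. pois_kernel \<tau> t x)"
    using pois_kernel_deriv by (intro continuous_at_imp_continuous_on) (blast intro: DERIV_isCont)
qed

lemma kern_measurable [measurable]: "kern x \<in> borel_measurable borel"
  unfolding kern_def[abs_def] by measurable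

lemma jump_op_density:
  assumes [measurable]: "\<And>x. f x \<in> borel_measurable borel" and f: "\<And>x t. t < 0 \<Longrightarrow> f x t = 0"
  shows "jump_op f x t = (\<integral>\<^sup>+a. ennreal (exp (- a / \<tau> x) / \<tau> x) * indicator {0..t} a *
     (ennreal (1/2) * (f (x - 1) (t - a) + f (x + 1) (t - a))) \<partial>lborel)"
  unfolding jump_op_def
  by (subst nn_integral_density)
     (auto intro!: nn_integral_cong simp: exponential_density_def indicator_def f)

lemma ennreal_half_sum:
  assumes "0 \<le> w" "0 \<le> p" "0 \<le> q"
  shows "ennreal w * (ennreal (1/2) * (ennreal p + ennreal q)) = ennreal (w * ((p + q) / 2))"
proof -
  have "ennreal w * (ennreal (1/2) * (ennreal p + ennreal q)) = ennreal w * ennreal (1/2 * (p + q))"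
    using assms ennreal_mult[of "1/2" "p + q"] by (simp only: ennreal_plus)
  also have "\<dots> = ennreal (w * (1/2 * (p + q)))"
    using assms by (intro ennreal_mult'[symmetric])
  finally show ?thesis by simp
qed

text \<open>Kolmogorov's equation in integrated form. The derivative of
  \<open>exp (- a / \<tau> x) * pois_kernel \<tau> (t - a) x\<close> in \<open>a\<close> contains no
  value at \<open>x\<close> itself, as the two contributions cancel; it is minus the renewal
  integrand up to the factor \<open>\<tau> 0\<close>.\<close>

lemma kern_renewal: "kern x t = path_mass \<tau> 0 x t + jump_op kern x t"
proof (cases "0 \<le> t")
  case False
  have "jump_op kern x t = 0"
    using False by (subst jump_op_density) (auto simp: kern_def)
  then show ?thesis using False by (simp add: kern_def path_mass_0)
next
  case t: True
  let ?u = "\<lambda>x t. pois_kernel \<tau> t x"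
  let ?f = "\<lambda>a. exp (- a / \<tau> x) / \<tau> x * ((\<tau> 0 * ?u (x - 1) (t - a) + \<tau> 0 * ?u (x + 1) (t - a)) / 2)"
  let ?F = "\<lambda>a. - \<tau> 0 * (exp (- a / \<tau> x) * ?u x (t - a))"
  have "jump_op kern x t = (\<integral>\<^sup>+a. ennreal (?f a) * indicator {0..t} a \<partial>lborel)"
  proof (subst jump_op_density, goal_cases)
    case 3
    show ?case
    proof (rule nn_integral_cong)
      fix a
      show "ennreal (exp (- a / \<tau> x) / \<tau> x) * indicator {0..t} a *
          (ennreal (1/2) * (kern (x - 1) (t - a) + kern (x + 1) (t - a))) = ennreal (?f a) * indicator {0..t} a"
      proof (cases "a \<in> {0..t}")
        case True
        then show ?thesis
          using pois_kernel_nonneg[of "t - a"]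
          by (subst ennreal_half_sum[symmetric]) (auto simp: kern_def)
      qed simp
    qed
  qed (auto simp: kern_def)
  moreover have deriv: "(?F has_real_derivative ?f a) (at a)" for a
  proof -
    have D: "((\<lambda>a. ?u x (t - a)) has_real_derivative - (lap (pois_kernel \<tau> (t - a)) x / (2 * \<tau> x))) (at a)"
    proof -
      have "((\<lambda>a. t - a) has_real_derivative -1) (at a)"
        by (auto intro!: derivative_eq_intros)
      from DERIV_chain2[where g="\<lambda>a. t - a", OF pois_kernel_deriv this, of x] show ?thesis by simp
    qed
    have E: "((\<lambda>a. exp (- a / \<tau> x)) has_real_derivative - (exp (- a / \<tau> x) / \<tau> x)) (at a)"
      by (auto intro!: derivative_eq_intros)
    have "(?F has_real_derivative - \<tau> 0 * (- (exp (- a / \<tau> x) / \<tau> x) * ?u x (t - a)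
        + - (lap (pois_kernel \<tau> (t - a)) x / (2 * \<tau> x)) * exp (- a / \<tau> x))) (at a)"
      by (intro DERIV_cmult DERIV_mult E D)
    also have "- \<tau> 0 * (- (exp (- a / \<tau> x) / \<tau> x) * ?u x (t - a)
        + - (lap (pois_kernel \<tau> (t - a)) x / (2 * \<tau> x)) * exp (- a / \<tau> x)) = ?f a"
      by (simp add: lap_def field_simps)
    finally show ?thesis .
  qed
  moreover have nn: "0 \<le> ?f a" if "a \<in> {0..t}" for a
    using that pois_kernel_nonneg[of "t - a"] by (auto intro!: mult_nonneg_nonneg)
  moreover have "(\<integral>\<^sup>+a. ennreal (?f a) * indicator {0..t} a \<partial>lborel) = ennreal (?F t - ?F 0)"
  proof (rule nn_integral_FTC_Icc)
    show "?f \<in> borel_measurable borel" by measurable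
  qed (use t deriv nn in \<open>blast+\<close>)
  moreover have "?F 0 \<le> ?F t"
  proof (rule DERIV_nonneg_imp_nondecreasing[OF t])
    fix a assume "0 \<le> a" "a \<le> t"
    then show "\<exists>y. (?F has_real_derivative y) (at a) \<and> 0 \<le> y"
      using deriv[of a] nn[of a] by (intro exI[of _ "?f a"]) auto
  qed
  ultimately have J: "jump_op kern x t = ennreal (?F t - ?F 0)" "?F 0 \<le> ?F t" by auto
  \<comment> \<open>The boundary term at \<open>a = t\<close>, where the kernel is the initial point
    mass: the walk has not yet jumped.\<close>
  define B where "B = (if x = 0 then exp (- t / \<tau> 0) else 0)"
  have F: "?F t - ?F 0 = \<tau> 0 * ?u x t - B"
    by (simp add: pois_kernel_0 B_def)
  have B: "path_mass \<tau> 0 x t = ennreal B" "0 \<le> B"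
    using t by (simp_all add: path_mass_0 B_def)
  have "kern x t = ennreal (B + (\<tau> 0 * ?u x t - B))"
    using t by (simp add: kern_def)
  also have "\<dots> = ennreal B + ennreal (\<tau> 0 * ?u x t - B)"
    using B J(2) F by (intro ennreal_plus) auto
  finally show ?thesis by (simp only: J(1) F B(1))
qed

lemma jump_op_mono: "(\<And>x t. f x t \<le> g x t) \<Longrightarrow> jump_op f x t \<le> jump_op g x t"
  unfolding jump_op_def by (intro nn_integral_mono mult_left_mono add_mono) auto

lemma path_mass_partial_Suc:
  "(\<Sum>k<Suc n. path_mass \<tau> k x t) = path_mass \<tau> 0 x t + jump_op (\<lambda>x t. \<Sum>k<n. path_mass \<tau> k x t) x t"
proof -
  have "jump_op (\<lambda>x t. \<Sum>k<n. path_mass \<tau> k x t) x t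
      = (\<integral>\<^sup>+a. (\<Sum>k<n. ennreal (1/2) * (path_mass \<tau> k (x - 1) (t - a) + path_mass \<tau> k (x + 1) (t - a))) \<partial>exp_law (\<tau> x))"
    unfolding jump_op_def sum_distrib_left[symmetric] sum.distrib ..
  also have "\<dots> = (\<Sum>k<n. jump_op (path_mass \<tau> k) x t)"
    unfolding jump_op_def by (rule nn_integral_sum) measurable
  finally show ?thesis
    by (simp only: sum.lessThan_Suc_shift path_mass_Suc)
qed

text \<open>The partial sums are the iterates of the renewal equation started from 0, and
  \<open>jump_op\<close> is monotone, so they stay below every solution.\<close>

lemma path_mass_partial_le: "(\<Sum>k<n. path_mass \<tau> k x t) \<le> kern x t"
proof (induction n arbitrary: x t)
  case (Suc n)
  then show ?case
    unfolding path_mass_partial_Suc kern_renewal[of x t]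
    by (intro add_left_mono jump_op_mono)
qed simp

text \<open>The converse, which excludes explosion: each iteration multiplies the error by the
  probability of a jump before \<open>t\<close>, at most \<open>1 - exp (- T)\<close> because \<tau>
  \<ge> 1. The bound \<open>T\<close> is kept apart from \<open>t\<close>, which varies in the
  induction.\<close>

lemma kern_le_partial:
  assumes "t \<le> T"
  shows "kern x t \<le> (\<Sum>k<n. path_mass \<tau> k x t) + ennreal (\<tau> 0 * (1 - exp (- T)) ^ n)"
  using assms
proof (induction n arbitrary: x t)
  case 0
  show ?case
  proof (cases "0 \<le> t")
    case True
    have "\<tau> 0 * pois_kernel \<tau> t x \<le> \<tau> 0 * 1"
      using True pois_kernel_le_1 by (intro mult_left_mono) auto
    then show ?thesis by (simp add: kern_def ennreal_leI)
  qed (simp add: kern_def)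
next
  case (Suc n)
  show ?case
  proof (cases "0 \<le> t")
    case False then show ?thesis by (simp add: kern_def)
  next
    case t: True
    let ?S = "\<lambda>x t. \<Sum>k<n. path_mass \<tau> k x t"
    let ?C = "\<tau> 0 * (1 - exp (- T)) ^ n" and ?w = "\<lambda>a. ennreal (exp (- a / \<tau> x) / \<tau> x) * indicator {0..t} a"
    have C: "0 \<le> ?C" using t Suc.prems by auto
    have S0: "?S x s = 0" if "s < 0" for x s
      using path_mass_partial_le[of x s n] that by (simp add: kern_def)
    have "jump_op kern x t = (\<integral>\<^sup>+a. ?w a * (ennreal (1/2) * (kern (x - 1) (t - a) + kern (x + 1) (t - a))) \<partial>lborel)"
      by (rule jump_op_density) (auto simp: kern_def)
    also have "\<dots> \<le> (\<integral>\<^sup>+a. ?w a * (ennreal (1/2) * (?S (x - 1) (t - a) + ?S (x + 1) (t - a))) + ?w a * ennreal ?C \<partial>lborel)"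
    proof (rule nn_integral_mono)
      fix a
      show "?w a * (ennreal (1/2) * (kern (x - 1) (t - a) + kern (x + 1) (t - a)))
        \<le> ?w a * (ennreal (1/2) * (?S (x - 1) (t - a) + ?S (x + 1) (t - a))) + ?w a * ennreal ?C"
      proof (cases "a \<in> {0..t}")
        case True
        have half: "ennreal (1/2) * (ennreal ?C + ennreal ?C) = ennreal ?C"
          using ennreal_half_sum[of 1 ?C ?C] C by simp
        have "ennreal (1/2) * (kern (x - 1) (t - a) + kern (x + 1) (t - a))
          \<le> ennreal (1/2) * ((?S (x - 1) (t - a) + ennreal ?C) + (?S (x + 1) (t - a) + ennreal ?C))"
          using True Suc.prems by (intro mult_left_mono add_mono Suc.IH) auto
        also have "\<dots> = ennreal (1/2) * (?S (x - 1) (t - a) + ?S (x + 1) (t - a)) + ennreal (1/2) * (ennreal ?C + ennreal ?C)"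
          by (simp only: distrib_left add_ac)
        finally show ?thesis unfolding half distrib_left[symmetric] by (rule mult_left_mono) simp
      qed simp
    qed
    also have "\<dots> = (\<integral>\<^sup>+a. ?w a * (ennreal (1/2) * (?S (x - 1) (t - a) + ?S (x + 1) (t - a))) \<partial>lborel)
        + (\<integral>\<^sup>+a. ?w a \<partial>lborel) * ennreal ?C"
      by (subst nn_integral_add) (auto simp: nn_integral_multc)
    also have "(\<integral>\<^sup>+a. ?w a * (ennreal (1/2) * (?S (x - 1) (t - a) + ?S (x + 1) (t - a))) \<partial>lborel) = jump_op ?S x t"
      using S0 by (intro jump_op_density[symmetric]) auto
    also have "jump_op ?S x t + (\<integral>\<^sup>+a. ?w a \<partial>lborel) * ennreal ?C
        \<le> jump_op ?S x t + ennreal (1 - exp (- T)) * ennreal ?C"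
    proof (intro add_left_mono mult_right_mono)
      have "(\<integral>\<^sup>+a. ?w a \<partial>lborel) = ennreal (- exp (- t / \<tau> x) - - exp (- 0 / \<tau> x))"
      proof (rule nn_integral_FTC_Icc)
        show "((\<lambda>y. - exp (- y / \<tau> x)) has_real_derivative exp (- a / \<tau> x) / \<tau> x) (at a)" for a
          by (auto intro!: derivative_eq_intros)
      qed (use t in auto)
      also have "\<dots> \<le> ennreal (1 - exp (- T))"
      proof (rule ennreal_leI)
        have "t * 1 \<le> T * \<tau> x" using t Suc.prems tau_ge_1[of x] by (intro mult_mono) auto
        then have "t / \<tau> x \<le> T" by (simp add: divide_le_eq)
        then show "- exp (- t / \<tau> x) - - exp (- 0 / \<tau> x) \<le> 1 - exp (- T)" by simp
      qed
      finally show "(\<integral>\<^sup>+a. ?w a \<partial>lborel) \<le> ennreal (1 - exp (- T))" .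
    qed simp
    also have "ennreal (1 - exp (- T)) * ennreal ?C = ennreal (\<tau> 0 * (1 - exp (- T)) ^ Suc n)"
      using C t Suc.prems by (subst ennreal_mult[symmetric]) (auto simp: mult_ac)
    finally have "jump_op kern x t \<le> jump_op ?S x t + ennreal (\<tau> 0 * (1 - exp (- T)) ^ Suc n)" .
    then show ?thesis
      unfolding path_mass_partial_Suc kern_renewal[of x t]
      by (simp add: add.assoc add_left_mono)
  qed
qed

text \<open>The two previous bounds squeeze the partial sums of the path series; the division by
  \<open>\<tau> 0\<close> undoes the factor in \<open>kern\<close>.\<close>

lemma heat_kernel_eq:
  assumes t: "0 \<le> t"
  shows "heat_kernel \<tau> t x 0 = pois_kernel \<tau> t x"
proof -
  let ?b = "\<lambda>n. \<Sum>xs\<in>nn_paths n x 0. (1/2) ^ n * hold_prob \<tau> xs t"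
  let ?p = "\<tau> 0 * pois_kernel \<tau> t x"
  have b: "0 \<le> ?b n" for n by (auto simp: hold_prob_def intro!: sum_nonneg)
  have p: "0 \<le> ?p" using t pois_kernel_nonneg by simp
  have partial: "(\<Sum>k<n. path_mass \<tau> k x t) = ennreal (\<Sum>k<n. ?b k)" for n
    unfolding path_mass_eq using b by (intro sum_ennreal)
  have up: "(\<Sum>k<n. ?b k) \<le> ?p" for n
    using path_mass_partial_le[of x t n] t p unfolding partial kern_def by simp
  have lo: "?p - \<tau> 0 * (1 - exp (- t)) ^ n \<le> (\<Sum>k<n. ?b k)" for n
  proof -
    have nn: "0 \<le> (\<Sum>k<n. ?b k)" "0 \<le> \<tau> 0 * (1 - exp (- t)) ^ n"
      using b t by (auto intro: sum_nonneg)
    have "ennreal ?p \<le> ennreal ((\<Sum>k<n. ?b k) + \<tau> 0 * (1 - exp (- t)) ^ n)"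
      using kern_le_partial[of t t x n] t nn unfolding partial kern_def by simp
    then have "?p \<le> (\<Sum>k<n. ?b k) + \<tau> 0 * (1 - exp (- t)) ^ n"
      using nn by (subst (asm) ennreal_le_iff) auto
    then show ?thesis by simp
  qed
  have lim: "(\<lambda>n. ?p - \<tau> 0 * (1 - exp (- t)) ^ n) \<longlonglongrightarrow> ?p - \<tau> 0 * 0"
    using t by (intro tendsto_intros LIMSEQ_power_zero) simp
  have "(\<lambda>n. \<Sum>k<n. ?b k) \<longlonglongrightarrow> ?p"
  proof (rule tendsto_sandwich[rotated 2])
    show "(\<lambda>n. ?p - \<tau> 0 * (1 - exp (- t)) ^ n) \<longlonglongrightarrow> ?p"
      using lim by (simp only: mult_zero_right diff_zero)
    show "(\<lambda>n. ?p) \<longlonglongrightarrow> ?p" by (rule tendsto_const)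
    show "\<forall>\<^sub>F n in sequentially. ?p - \<tau> 0 * (1 - exp (- t)) ^ n \<le> (\<Sum>k<n. ?b k)"
      by (intro always_eventually allI lo)
    show "\<forall>\<^sub>F n in sequentially. (\<Sum>k<n. ?b k) \<le> ?p"
      by (intro always_eventually allI up)
  qed
  then have "?b sums ?p" unfolding sums_def .
  then have "(\<Sum>n. ?b n) = ?p" by (rule sums_unique[symmetric])
  then show ?thesis
    unfolding heat_kernel_def trans_prob_def by simp
qed

end

section \<open>Sums of heavy-tailed variables\<close>

text \<open>The events \<open>B k\<close> are the failures. If all failures from \<open>n\<close> on
  had positive joint probability, the product formula and \<open>1 - x \<le> exp (- x)\<close> would
  bound the partial sums of \<open>1 - prob (B k)\<close> by minus its logarithm.\<close>

lemma (in prob_space) borel_cantelli_second: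
  fixes B :: "nat \<Rightarrow> 'a set"
  assumes ind: "indep_events B UNIV" and div: "\<not> summable (\<lambda>k. 1 - prob (B k))"
  shows "AE \<omega> in M. \<exists>\<^sub>F k in sequentially. \<omega> \<notin> B k"
proof -
  have B [measurable]: "B k \<in> events" for k
    using ind by (auto simp: indep_events_def)
  define D where "D n = (\<Inter>k\<in>{n..}. B k)" for n
  have D [measurable]: "D n \<in> events" for n
    unfolding D_def by measurable
  have zero: "prob (D n) = 0" for n
  proof (rule ccontr)
    assume "prob (D n) \<noteq> 0"
    then have pos: "0 < prob (D n)" using measure_nonneg[of M "D n"] by linarith
    have "(\<Sum>k<m. 1 - prob (B (k + n))) \<le> - ln (prob (D n))" for m
    proof (cases "m = 0")
      case True
      then show ?thesis using pos prob_le_1[of "D n"] by (simp add: ln_le_zero_iff)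
    next
      case False
      have "prob (D n) \<le> prob (\<Inter>k\<in>{n..<m+n}. B k)"
        unfolding D_def using False
        by (intro finite_measure_mono sets.finite_INT) auto
      also have "\<dots> = (\<Prod>k\<in>{n..<m+n}. prob (B k))"
        using ind False by (auto simp: indep_events_def)
      also have "\<dots> = (\<Prod>k<m. prob (B (k + n)))"
        by (rule prod.reindex_bij_witness[of _ "\<lambda>k. k + n" "\<lambda>k. k - n"]) auto
      also have "\<dots> \<le> (\<Prod>k<m. exp (- (1 - prob (B (k + n)))))"
      proof (intro prod_mono conjI)
        show "prob (B (k + n)) \<le> exp (- (1 - prob (B (k + n))))" for k
          using exp_ge_add_one_self[of "- (1 - prob (B (k + n)))"] by simp
      qed auto
      also have "\<dots> = exp (- (\<Sum>k<m. 1 - prob (B (k + n))))"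
        by (simp add: exp_sum sum_negf[symmetric])
      finally have "ln (prob (D n)) \<le> ln (exp (- (\<Sum>k<m. 1 - prob (B (k + n)))))"
        using pos by (subst ln_le_cancel_iff) auto
      then show ?thesis by simp
    qed
    then have "summable (\<lambda>k. 1 - prob (B (k + n)))"
      by (intro summableI_nonneg_bounded[where x = "- ln (prob (D n))"]) auto
    with div show False using summable_iff_shift[of "\<lambda>k. 1 - prob (B k)" n] by blast
  qed
  have "AE \<omega> in M. \<omega> \<notin> D n" for n
    using zero[of n] by (intro AE_not_in) (auto simp: emeasure_eq_measure null_sets_def)
  then have "AE \<omega> in M. \<forall>n. \<omega> \<notin> D n" by (simp add: AE_all_countable)
  then show ?thesis
    by eventually_elim (auto simp: D_def frequently_sequentially)
qed

lemma not_summable_inverse_n_ln: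
  "\<not> summable (\<lambda>n. c / (real n * ln (real n)))" if "c \<noteq> 0"
proof
  assume "summable (\<lambda>n. c / (real n * ln (real n)))"
  then have "summable (\<lambda>n. inverse c * (c / (real n * ln (real n))))" by (rule summable_mult)
  then have s: "summable (\<lambda>n. 1 / (real n * ln (real n)))" using that by (simp add: field_simps)
  \<comment> \<open>\<open>max 2 n\<close> avoids the indices 0 and 1, where the logarithm is not
    positive, and makes \<open>f\<close> antimonotone as Cauchy condensation requires.\<close>
  define f where "f n = 1 / (real (max 2 n) * ln (real (max 2 n)))" for n
  have "summable f"
    using s by (rule summable_cong[THEN iffD1, rotated])
      (auto simp: f_def eventually_sequentially max_def intro!: exI[of _ 2])
  moreover have "summable f \<longleftrightarrow> summable (\<lambda>n. 2 ^ n * f (2 ^ n))"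
  proof (rule condensation_test)
    show "0 \<le> f n" for n by (simp add: f_def)
    show "f (Suc m) \<le> f m" for m
      unfolding f_def by (intro divide_left_mono mult_mono mult_pos_pos) auto
  qed
  ultimately have "summable (\<lambda>n. 2 ^ n * f (2 ^ n))" by simp
  then have "summable (\<lambda>n. inverse (real n) * inverse (ln 2))"
  proof (rule summable_cong[THEN iffD1, rotated])
    have "2 ^ n * f (2 ^ n) = inverse (real n) * inverse (ln 2)" if "n \<ge> 1" for n
    proof -
      have "max 2 (2 ^ n) = (2::nat) ^ n" using power_increasing[OF that, of "2::nat"] by simp
      then show ?thesis by (simp add: f_def ln_realpow field_simps)
    qed
    then show "\<forall>\<^sub>F n in sequentially. 2 ^ n * f (2 ^ n) = inverse (real n) * inverse (ln 2)"
      by (auto simp: eventually_sequentially)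
  qed
  then have "summable (\<lambda>n. inverse (real n) * inverse (ln 2) * ln 2)" by (rule summable_mult2)
  moreover have "(\<lambda>n. inverse (real n) * inverse (ln 2) * ln 2) = (\<lambda>n. inverse (real n))" by auto
  ultimately show False using not_summable_harmonic[where 'a=real] by (simp only:)
qed

lemma dyadic_above:
  fixes y :: real
  assumes "1 \<le> y"
  obtains k where "y \<le> 2 ^ k" "2 ^ k \<le> 2 * y"
proof -
  define i where "i = nat \<lceil>log 2 y\<rceil>"
  have l: "0 \<le> log 2 y" using assms by simp
  then have i: "log 2 y \<le> real i" "real i \<le> log 2 y + 1" unfolding i_def by linarith+
  have "y = 2 powr log 2 y" using assms by simp
  also have "\<dots> \<le> 2 powr real i" using i by (intro powr_mono) auto
  finally have u1: "y \<le> 2 ^ i" by (simp add: powr_realpow)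
  have "2 ^ i = 2 powr real i" by (simp add: powr_realpow)
  also have "\<dots> \<le> 2 powr (log 2 y + 1)" using i by (intro powr_mono) auto
  also have "\<dots> = 2 * y" using assms by (simp add: powr_add)
  finally show thesis using u1 that by blast
qed

lemma exponent_le_ln:
  fixes y :: real
  assumes "2 ^ k \<le> y"
  shows "real k \<le> 2 * ln y"
proof -
  have "(0::real) < 2 ^ k" by simp
  then have y: "0 < y" using assms by linarith
  have "real k * ln 2 = ln (2 ^ k)" by (simp add: ln_realpow)
  also have "\<dots> \<le> ln y" using assms y by (subst ln_le_cancel_iff) auto
  finally have "real k * ln 2 \<le> ln y" .
  moreover have "real k * (1/2) \<le> real k * ln 2"
    using ln2_ge_two_thirds by (intro mult_left_mono) auto
  ultimately show ?thesis by simp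
qed

locale heavy_tailed_traps = prob_space M for M :: "'w measure" +
  fixes \<tau> :: "'w \<Rightarrow> int \<Rightarrow> real" and \<alpha> :: real
  assumes alpha: "0 < \<alpha>" "\<alpha> < 1"
    and tau_measurable [measurable]: "\<And>x. (\<lambda>\<omega>. \<tau> \<omega> x) \<in> borel_measurable M"
    and tau_indep: "indep_vars (\<lambda>_. borel) (\<lambda>x \<omega>. \<tau> \<omega> x) UNIV"
    and tau_tail: "\<And>x u. 1 \<le> u \<Longrightarrow> prob {\<omega> \<in> space M. \<tau> \<omega> x > u} = u powr (- \<alpha>)"
begin

abbreviation S :: "int set \<Rightarrow> 'w \<Rightarrow> real" where "S A \<omega> \<equiv> \<Sum>x\<in>A. \<tau> \<omega> x"

lemma AE_traps: "AE \<omega> in M. traps (\<tau> \<omega>)"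
proof -
  have "AE \<omega> in M. 1 \<le> \<tau> \<omega> x" for x
  proof -
    have "prob {\<omega> \<in> space M. \<tau> \<omega> x > 1} = 1" using tau_tail[of 1 x] by simp
    then have "AE \<omega> in M. \<omega> \<in> {\<omega> \<in> space M. \<tau> \<omega> x > 1}"
      by (subst (asm) prob_eq_1) auto
    then show ?thesis by eventually_elim auto
  qed
  then have "AE \<omega> in M. \<forall>x. 1 \<le> \<tau> \<omega> x" by (simp add: AE_all_countable)
  then show ?thesis by eventually_elim (simp add: traps_def)
qed

text \<open>\<open>Q\<close> describes the event on the product space over a block, where
  measurability is checked; \<open>R\<close> is the same event in the form used later.\<close>

lemma indep_events_blocks:
  assumes "disjoint_family_on K L"
    and "\<And>j. j \<in> L \<Longrightarrow> {f \<in> space (PiM (K j) (\<lambda>_. borel)). Q j f} \<in> sets (PiM (K j) (\<lambda>_. borel))"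
    and "\<And>j \<omega>. j \<in> L \<Longrightarrow> Q j (restrict (\<tau> \<omega>) (K j)) \<longleftrightarrow> R j \<omega>"
  shows "indep_events (\<lambda>j. {\<omega> \<in> space M. R j \<omega>}) L"
proof -
  have "indep_vars (\<lambda>j. PiM (K j) (\<lambda>_. borel)) (\<lambda>j \<omega>. restrict (\<lambda>x. \<tau> \<omega> x) (K j)) L"
    by (rule indep_vars_restrict[OF tau_indep _ assms(1)]) auto
  from indep_eventsI_indep_vars[OF this assms(2)]
  have "indep_events (\<lambda>j. {\<omega> \<in> space M. Q j (restrict (\<tau> \<omega>) (K j))}) L" .
  then show ?thesis
    unfolding indep_events_def using assms(3)
    by (auto simp: subset_eq cong: conj_cong) 
qed

text \<open>The level is exceeded with probability \<open>K powr (-\<alpha>) / (n * ln n)\<close>,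
  which is not summable however large \<open>K\<close> is.\<close>

lemma big_trap:
  assumes "0 < K"
  shows "AE \<omega> in M. \<exists>\<^sub>F n in sequentially. \<tau> \<omega> (int n) > K * (real n * ln (real n)) powr (1/\<alpha>)"
proof -
  define v where "v n = K * (real n * ln (real n)) powr (1/\<alpha>)" for n
  let ?B = "\<lambda>n. {\<omega> \<in> space M. \<not> \<tau> \<omega> (int n) > v n}"
  have "filterlim v at_top sequentially"
    unfolding v_def using assms alpha by real_asymp
  then have ev: "\<forall>\<^sub>F n in sequentially. 1 \<le> v n" by (simp add: filterlim_at_top)
  have "AE \<omega> in M. \<exists>\<^sub>F n in sequentially. \<omega> \<notin> ?B n"
  proof (rule borel_cantelli_second)
    show "indep_events ?B UNIV"
      by (rule indep_events_blocks[where K = "\<lambda>n. {int n}" and Q = "\<lambda>n f. \<not> f (int n) > v n"])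
         (auto simp: disjoint_family_on_def)
    have "1 - prob (?B n) = prob {\<omega> \<in> space M. \<tau> \<omega> (int n) > v n}" for n
      using prob_neg[of "\<lambda>\<omega>. \<tau> \<omega> (int n) > v n"] by simp
    moreover have "\<forall>\<^sub>F n in sequentially. prob {\<omega> \<in> space M. \<tau> \<omega> (int n) > v n} = K powr (-\<alpha>) / (real n * ln (real n))"
      using ev eventually_gt_at_top[of 1]
    proof eventually_elim
      case (elim n)
      have "(K * (real n * ln (real n)) powr (1/\<alpha>)) powr (-\<alpha>) = K powr (-\<alpha>) * (real n * ln (real n)) powr (-1)"
        using elim assms alpha by (simp add: powr_mult powr_powr)
      then show ?case
        using elim by (simp add: tau_tail v_def powr_minus_divide)
    qed
    ultimately have "\<forall>\<^sub>F n in sequentially. 1 - prob (?B n) = K powr (-\<alpha>) / (real n * ln (real n))" by simp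
    from summable_cong[OF this] show "\<not> summable (\<lambda>n. 1 - prob (?B n))"
      using not_summable_inverse_n_ln[of "K powr (-\<alpha>)"] assms by simp
  qed
  then show ?thesis
    using AE_space
  proof eventually_elim
    case (elim \<omega>)
    from elim(1) show ?case
      by (rule frequently_elim1) (use elim(2) in \<open>auto simp: v_def\<close>)
  qed
qed

text \<open>Truncated means: doubling the truncation level \<open>u\<close> costs at most \<open>u P(\<tau> > u)\<close>.\<close>

definition "trunc_const = 1 / (2 powr (1 - \<alpha>) - 1)"

lemma trunc_const_ge_1: "1 \<le> trunc_const"
proof -
  have "2 powr (1 - \<alpha>) \<le> (2::real) powr 1" using alpha by (intro powr_mono) auto
  moreover have "1 < (2::real) powr (1 - \<alpha>)" using alpha by (intro gr_one_powr) auto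
  ultimately show ?thesis unfolding trunc_const_def by (simp add: field_simps)
qed

lemma trunc_mean_pow2:
  "(\<integral>\<^sup>+\<omega>. ennreal (min (\<tau> \<omega> x) (2 ^ i)) \<partial>M) \<le> ennreal (trunc_const * (2 ^ i) powr (1 - \<alpha>))"
proof (induction i)
  case 0
  have "(\<integral>\<^sup>+\<omega>. ennreal (min (\<tau> \<omega> x) (2 ^ 0)) \<partial>M) \<le> (\<integral>\<^sup>+\<omega>. 1 \<partial>M)"
    by (intro nn_integral_mono) (auto simp: ennreal_le_1)
  also have "\<dots> = 1" by (simp add: emeasure_space_1)
  also have "\<dots> \<le> ennreal (trunc_const * (2 ^ 0) powr (1 - \<alpha>))"
    using trunc_const_ge_1 by simp
  finally show ?case .
next
  case (Suc i)
  let ?u = "2 ^ i :: real"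
  have "(\<integral>\<^sup>+\<omega>. ennreal (min (\<tau> \<omega> x) (2 ^ Suc i)) \<partial>M)
      \<le> (\<integral>\<^sup>+\<omega>. ennreal (min (\<tau> \<omega> x) ?u) + ennreal ?u * indicator {\<omega>\<in>space M. \<tau> \<omega> x > ?u} \<omega> \<partial>M)"
  proof (rule nn_integral_mono)
    fix \<omega> assume "\<omega> \<in> space M"
    then show "ennreal (min (\<tau> \<omega> x) (2 ^ Suc i)) \<le> ennreal (min (\<tau> \<omega> x) ?u) + ennreal ?u * indicator {\<omega>\<in>space M. \<tau> \<omega> x > ?u} \<omega>"
      by (cases "\<tau> \<omega> x > ?u") (auto simp: indicator_def min_def ennreal_plus[symmetric] simp del: ennreal_plus intro!: ennreal_leI)
  qed
  also have "\<dots> = (\<integral>\<^sup>+\<omega>. ennreal (min (\<tau> \<omega> x) ?u) \<partial>M) + ennreal ?u * emeasure M {\<omega>\<in>space M. \<tau> \<omega> x > ?u}"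
    by (subst nn_integral_add) (auto simp: nn_integral_cmult)
  also have "emeasure M {\<omega>\<in>space M. \<tau> \<omega> x > ?u} = ennreal (?u powr (-\<alpha>))"
    by (simp add: emeasure_eq_measure tau_tail)
  also have "(\<integral>\<^sup>+\<omega>. ennreal (min (\<tau> \<omega> x) ?u) \<partial>M) + ennreal ?u * ennreal (?u powr (-\<alpha>))
      \<le> ennreal (trunc_const * ?u powr (1 - \<alpha>)) + ennreal ?u * ennreal (?u powr (-\<alpha>))"
    by (intro add_right_mono Suc.IH)
  also have "\<dots> = ennreal (trunc_const * ?u powr (1 - \<alpha>) + ?u * ?u powr (-\<alpha>))"
    using trunc_const_ge_1 by (simp add: ennreal_mult'[symmetric])
  also have "trunc_const * ?u powr (1 - \<alpha>) + ?u * ?u powr (-\<alpha>) = trunc_const * (2 ^ Suc i) powr (1 - \<alpha>)"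
  proof -
    have "?u * ?u powr (-\<alpha>) = ?u powr (1 - \<alpha>)"
      using powr_add[of ?u 1 "-\<alpha>"] by simp
    \<comment> \<open>\<open>trunc_const\<close> is defined as the solution of this equation, which
      closes the induction.\<close>
    moreover have "trunc_const + 1 = trunc_const * 2 powr (1 - \<alpha>)"
      using gr_one_powr[of 2 "1 - \<alpha>"] alpha by (simp add: trunc_const_def field_simps)
    moreover have "(2 ^ Suc i) powr (1 - \<alpha>) = 2 powr (1 - \<alpha>) * ?u powr (1 - \<alpha>)"
      by (simp add: powr_mult)
    ultimately show ?thesis by (simp add: algebra_simps) (metis distrib_right mult.assoc mult.commute mult_1)
  qed
  finally show ?case .
qed

definition "tail_const = trunc_const * 2 powr (1 - \<alpha>)"

lemma tail_const_pos: "0 < tail_const"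
  using trunc_const_ge_1 by (auto simp: tail_const_def intro!: mult_pos_pos)

lemma trunc_mean:
  assumes "1 \<le> u"
  shows "(\<integral>\<^sup>+\<omega>. ennreal (min (\<tau> \<omega> x) u) \<partial>M) \<le> ennreal (tail_const * u powr (1 - \<alpha>))"
proof -
  obtain i where u1: "u \<le> 2 ^ i" and u2: "2 ^ i \<le> 2 * u"
    using dyadic_above[OF assms] by metis
  have "(\<integral>\<^sup>+\<omega>. ennreal (min (\<tau> \<omega> x) u) \<partial>M) \<le> (\<integral>\<^sup>+\<omega>. ennreal (min (\<tau> \<omega> x) (2 ^ i)) \<partial>M)"
    using u1 by (intro nn_integral_mono ennreal_leI) auto
  also note trunc_mean_pow2
  also have "ennreal (trunc_const * (2 ^ i) powr (1 - \<alpha>)) \<le> ennreal (trunc_const * (2 * u) powr (1 - \<alpha>))"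
    using u2 alpha trunc_const_ge_1 by (intro ennreal_leI mult_left_mono powr_mono2) auto
  finally show ?thesis
    using assms by (simp add: tail_const_def powr_mult mult.assoc)
qed

text \<open>Markov's inequality for the sum truncated at \<open>u\<close>, which has finite mean.
  Nothing is lost: a single trap deeper than \<open>u\<close> already brings the truncated sum to
  \<open>u\<close>.\<close>

lemma sum_tail:
  assumes A: "finite A" and u: "1 \<le> u"
  shows "prob {\<omega> \<in> space M. S A \<omega> > u} \<le> tail_const * real (card A) * u powr (-\<alpha>)"
proof -
  let ?f = "\<lambda>\<omega>. \<Sum>x\<in>A. ennreal (min (\<tau> \<omega> x) u)"
  have sub: "{\<omega> \<in> space M. S A \<omega> > u} \<subseteq> {\<omega> \<in> space M. 1 \<le> ennreal (1 / u) * ?f \<omega>}"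
  proof safe
    fix \<omega> assume w: "u < S A \<omega>"
    have "ennreal u \<le> ?f \<omega>"
    proof (cases "\<exists>x\<in>A. u \<le> \<tau> \<omega> x")
      case True
      then obtain x where x: "x \<in> A" "u \<le> \<tau> \<omega> x" by auto
      then have "ennreal u = ennreal (min (\<tau> \<omega> x) u)" by simp
      also have "\<dots> \<le> ?f \<omega>" using x A by (intro member_le_sum) auto
      finally show ?thesis .
    next
      case False
      \<comment> \<open>The inclusion is proved for every outcome, also the negligible ones with
        negative \<tau>; hence \<open>max 0\<close>.\<close>
      have "ennreal u \<le> ennreal (\<Sum>x\<in>A. max 0 (\<tau> \<omega> x))"
        using w by (intro ennreal_leI order.trans[OF less_imp_le[OF w]] sum_mono) auto
      also have "\<dots> = (\<Sum>x\<in>A. ennreal (max 0 (\<tau> \<omega> x)))" by (intro sum_ennreal[symmetric]) auto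
      also have "\<dots> = ?f \<omega>"
        using False by (intro sum.cong refl) (auto simp: min_def max_def ennreal_neg not_le)
      finally show ?thesis .
    qed
    then have "ennreal (1 / u) * ennreal u \<le> ennreal (1 / u) * ?f \<omega>" by (intro mult_left_mono) auto
    then show "1 \<le> ennreal (1 / u) * ?f \<omega>" using u by (simp add: ennreal_mult'[symmetric])
  qed
  have "emeasure M {\<omega> \<in> space M. S A \<omega> > u} \<le> emeasure M {\<omega> \<in> space M. 1 \<le> ennreal (1 / u) * ?f \<omega>}"
    by (intro emeasure_mono sub) measurable
  also have "\<dots> \<le> ennreal (1 / u) * (\<integral>\<^sup>+\<omega>. ?f \<omega> * indicator (space M) \<omega> \<partial>M)"
    by (intro nn_integral_Markov_inequality) measurable
  also have "(\<integral>\<^sup>+\<omega>. ?f \<omega> * indicator (space M) \<omega> \<partial>M) = (\<integral>\<^sup>+\<omega>. ?f \<omega> \<partial>M)"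
    by (intro nn_integral_cong) auto
  also have "\<dots> = (\<Sum>x\<in>A. \<integral>\<^sup>+\<omega>. ennreal (min (\<tau> \<omega> x) u) \<partial>M)"
    by (rule nn_integral_sum) measurable
  also have "ennreal (1 / u) * \<dots> \<le> ennreal (1 / u) * (\<Sum>x\<in>A. ennreal (tail_const * u powr (1 - \<alpha>)))"
    using u by (intro mult_left_mono sum_mono trunc_mean) auto
  also have "\<dots> = ennreal (1 / u * (real (card A) * (tail_const * u powr (1 - \<alpha>))))"
    using tail_const_pos u by (simp add: ennreal_mult' ennreal_of_nat_eq_real_of_nat del: times_divide_eq_left times_divide_eq_right)
  also have "1 / u * (real (card A) * (tail_const * u powr (1 - \<alpha>))) = tail_const * real (card A) * u powr (-\<alpha>)"
    using u by (simp add: powr_diff powr_minus field_simps)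
  finally show ?thesis
    using tail_const_pos by (simp add: emeasure_eq_measure ennreal_le_iff)
qed

section \<open>Lower tails through the Laplace transform, and almost sure growth\<close>

lemma integrable_exp_tau:
  assumes "0 < s"
  shows "integrable M (\<lambda>\<omega>. exp (- s * \<tau> \<omega> x))"
proof (rule integrable_const_bound[where B = 1])
  show "AE \<omega> in M. norm (exp (- s * \<tau> \<omega> x)) \<le> 1"
    using AE_traps
  proof eventually_elim
    case (elim \<omega>)
    then interpret traps "\<tau> \<omega>" .
    show ?case using tau_pos(3)[of x] assms by auto
  qed
qed measurable

text \<open>Only traps deeper than \<open>1 / s\<close> are counted: each brings the exponential
  below \<open>exp (-1) \<le> 1/2\<close>, and they occur with probability
  \<open>s powr \<alpha>\<close>.\<close>

lemma laplace_bound: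
  assumes "0 < s" "s \<le> 1"
  shows "expectation (\<lambda>\<omega>. exp (- s * \<tau> \<omega> x)) \<le> exp (- (s powr \<alpha>) / 2)"
proof -
  let ?I = "\<lambda>\<omega>. indicator {\<omega>\<in>space M. \<tau> \<omega> x > 1 / s} \<omega> :: real"
  have I: "integrable M ?I" by (intro integrable_const_bound[where B = 1]) (auto simp: indicator_def)
  have e: "exp (-1) \<le> (1/2::real)"
    using exp_ge_add_one_self[of 1] by (simp add: exp_minus field_simps)
  have "expectation (\<lambda>\<omega>. exp (- s * \<tau> \<omega> x)) \<le> expectation (\<lambda>\<omega>. 1 - 1/2 * ?I \<omega>)"
  proof (rule integral_mono_AE)
    show "integrable M (\<lambda>\<omega>. exp (- s * \<tau> \<omega> x))"
      using assms by (intro integrable_exp_tau)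
    show "integrable M (\<lambda>\<omega>. 1 - 1/2 * ?I \<omega>)"
      by (intro integrable_const_bound[where B = 1]) (auto simp: indicator_def)
    show "AE \<omega> in M. exp (- s * \<tau> \<omega> x) \<le> 1 - 1/2 * ?I \<omega>"
      using AE_traps
    proof eventually_elim
      case (elim \<omega>)
      then interpret traps "\<tau> \<omega>" .
      show ?case
      proof (cases "?I \<omega> = 0")
        case True then show ?thesis using tau_pos(3)[of x] assms by simp
      next
        case False
        then have "1 / s < \<tau> \<omega> x" by (auto simp: indicator_def split: if_splits)
        then have "exp (- s * \<tau> \<omega> x) \<le> exp (-1)" using assms by (simp add: field_simps)
        moreover have "?I \<omega> = 1" using False by (auto simp: indicator_def split: if_splits)
        ultimately show ?thesis using e by linarith
      qed
    qed
  qed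
  also have "\<dots> = 1 - 1/2 * (1/s) powr (-\<alpha>)"
    using assms I by (simp add: tau_tail prob_space)
  also have "(1/s) powr (-\<alpha>) = s powr \<alpha>" using assms by (simp add: powr_divide powr_minus)
  also have "1 - 1/2 * s powr \<alpha> \<le> exp (- (s powr \<alpha>) / 2)"
    using exp_ge_add_one_self[of "- (s powr \<alpha>) / 2"] by simp
  finally show ?thesis .
qed

lemma sum_lower_tail:
  assumes A: "finite A" and s: "0 < s" "s \<le> 1"
  shows "prob {\<omega> \<in> space M. S A \<omega> < v} \<le> exp (s * v - real (card A) * s powr \<alpha> / 2)"
proof -
  let ?X = "\<lambda>x \<omega>. exp (- s * \<tau> \<omega> x)"
  have int: "integrable M (?X x)" for x
    using s by (intro integrable_exp_tau)
  have ind: "indep_vars (\<lambda>_. borel) ?X A"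
    using indep_vars_compose2[OF indep_vars_subset[OF tau_indep], of A "\<lambda>_ y. exp (- s * y)" "\<lambda>_. borel"]
    by simp
  have P: "integrable M (\<lambda>\<omega>. \<Prod>x\<in>A. ?X x \<omega>)"
    "expectation (\<lambda>\<omega>. \<Prod>x\<in>A. ?X x \<omega>) = (\<Prod>x\<in>A. expectation (?X x))"
    using indep_vars_integrable[OF A ind int] indep_vars_lebesgue_integral[OF A ind int] by auto
  have "prob {\<omega> \<in> space M. S A \<omega> < v} = expectation (indicator {\<omega> \<in> space M. S A \<omega> < v})"
    by simp
  also have "\<dots> \<le> expectation (\<lambda>\<omega>. exp (s * v) * (\<Prod>x\<in>A. ?X x \<omega>))"
  proof (rule integral_mono_AE)
    show "AE \<omega> in M. indicator {\<omega> \<in> space M. S A \<omega> < v} \<omega> \<le> exp (s * v) * (\<Prod>x\<in>A. ?X x \<omega>)"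
    proof (rule AE_I2)
      fix \<omega>
      have "exp (s * v) * (\<Prod>x\<in>A. ?X x \<omega>) = exp (s * (v - S A \<omega>))"
        by (simp add: exp_sum[OF A, symmetric] exp_add[symmetric] algebra_simps sum_distrib_left sum_negf)
      then show "indicator {\<omega> \<in> space M. S A \<omega> < v} \<omega> \<le> exp (s * v) * (\<Prod>x\<in>A. ?X x \<omega>)"
        using s by (auto simp: indicator_def)
    qed
  qed (use P(1) in \<open>auto simp: less_top[symmetric]\<close>)
  also have "\<dots> = exp (s * v) * (\<Prod>x\<in>A. expectation (?X x))"
    using P(2) by simp
  also have "\<dots> \<le> exp (s * v) * (\<Prod>x\<in>A. exp (- (s powr \<alpha>) / 2))"
    using s by (intro mult_left_mono prod_mono) (auto simp: laplace_bound[simplified])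
  also have "\<dots> = exp (s * v - real (card A) * s powr \<alpha> / 2)"
    by (simp add: exp_of_nat_mult[symmetric] exp_add[symmetric] algebra_simps)
  finally show ?thesis .
qed


text \<open>At this level \<open>u\<close> the product \<open>2 ^ k * u powr (-\<alpha>)\<close> is
  \<open>1 / k^2\<close>, so \<open>sum_tail\<close> and the first Borel-Cantelli lemma apply along
  dyadic radii.\<close>

lemma upper_growth:
  "AE \<omega> in M. \<forall>\<^sub>F k in sequentially. S {-(2^k)..2^k} \<omega> \<le> (2 ^ k * real k ^ 2) powr (1/\<alpha>)"
proof -
  let ?u = "\<lambda>k. (2 ^ k * real k ^ 2) powr (1/\<alpha>)"
  \<comment> \<open>At \<open>k = 0\<close> the level is 0, outside the range of
    \<open>sum_tail\<close>.\<close>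
  define E where "E k = (if k = 0 then {} else {\<omega> \<in> space M. S {-(2^k)..2^k} \<omega> > ?u k})" for k
  have [measurable]: "E k \<in> events" for k unfolding E_def by auto
  have prob: "prob (E k) \<le> 3 * tail_const * inverse (real k ^ 2)" for k
  proof (cases "k = 0")
    case False
    then have k: "1 \<le> k" by simp
    have u1: "1 \<le> ?u k" using k alpha by (intro ge_one_powr_ge_zero mult_ge1_I) auto
    have "prob (E k) \<le> tail_const * real (card {-(2^k)..(2^k::int)}) * ?u k powr (-\<alpha>)"
    proof -
      have "E k = {\<omega> \<in> space M. S {-(2^k)..2^k} \<omega> > ?u k}" using False by (simp add: E_def)
      then show ?thesis using sum_tail[OF _ u1, of "{-(2^k)..2^k}"] by (simp only: finite_atLeastAtMost_int)
    qed
    also have "?u k powr (-\<alpha>) = inverse (2 ^ k * real k ^ 2)"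
      using alpha k by (simp add: powr_powr powr_minus powr_one)
    also have "real (card {-(2^k)..(2^k::int)}) \<le> 3 * 2 ^ k"
      by (simp add: nat_add_distrib nat_mult_distrib nat_power_eq)
    finally have "prob (E k) \<le> tail_const * (3 * 2 ^ k) * inverse (2 ^ k * real k ^ 2)"
      using tail_const_pos by (simp add: mult_left_mono mult_right_mono)
    then show ?thesis by (simp add: field_simps)
  qed (simp add: E_def)
  have "summable (\<lambda>k. prob (E k))"
  proof (rule summable_comparison_test')
    show "summable (\<lambda>k. 3 * tail_const * inverse (real k ^ 2))"
      by (intro summable_mult inverse_power_summable) simp
    show "norm (prob (E k)) \<le> 3 * tail_const * inverse (real k ^ 2)" if "k \<ge> 0" for k
      using prob[of k] by simp
  qed
  then have "AE \<omega> in M. \<forall>\<^sub>F k in sequentially. \<omega> \<in> space M - E k"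
    by (intro borel_cantelli_AE1) (auto simp: less_top[symmetric])
  then show ?thesis
  proof eventually_elim
    case (elim \<omega>)
    then show ?case using eventually_gt_at_top[of 0]
      by eventually_elim (auto simp: E_def)
  qed
qed

text \<open>Exponential Chebyshev with \<open>s\<close> chosen so that \<open>2 ^ k s powr \<alpha> = 8 ln k\<close>.\<close>

lemma lower_growth:
  defines "c \<equiv> 2 * (1/8) powr (1/\<alpha>)"
  shows "AE \<omega> in M. \<forall>\<^sub>F k in sequentially.
     c * (2 ^ k) powr (1/\<alpha>) * ln (real k) powr (- ((1 - \<alpha>) / \<alpha>)) \<le> S {0..2^k} \<omega>"
proof -
  define v where "v k = c * (2 ^ k) powr (1/\<alpha>) * ln (real k) powr (- ((1 - \<alpha>) / \<alpha>))" for k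
  define s where "s k = (8 * ln (real k) / 2 ^ k) powr (1/\<alpha>)" for k
  have "((\<lambda>k. 8 * ln (real k) / 2 ^ k) \<longlongrightarrow> 0) sequentially" by real_asymp
  then have ev: "\<forall>\<^sub>F k in sequentially. 8 * ln (real k) / 2 ^ k < 1"
    by (rule order_tendstoD) simp
  define E where "E k = {\<omega> \<in> space M. S {0..2^k} \<omega> < v k}" for k
  have [measurable]: "E k \<in> events" for k unfolding E_def by auto
  have "\<forall>\<^sub>F k in sequentially. norm (prob (E k)) \<le> inverse (real k ^ 2)"
    using ev eventually_gt_at_top[of 1]
  proof eventually_elim
    case (elim k)
    define L where "L = ln (real k)"
    have L: "0 < L" unfolding L_def using elim by simp
    have s: "0 < s k" "s k \<le> 1"
      using elim L alpha powr_mono2[of "1/\<alpha>" "8 * ln (real k) / 2 ^ k" 1] by (auto simp: s_def L_def)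
    have sa: "s k powr \<alpha> = 8 * L / 2 ^ k"
      using alpha L by (simp add: s_def powr_powr L_def)
    \<comment> \<open>The \<open>(1/8) powr (1/\<alpha>)\<close> in \<open>c\<close> cancels the 8
      in \<open>s\<close>, leaving \<open>2 * L\<close>. Against the loss \<open>4 * L\<close> from
      the Laplace transform this gives probability at most \<open>1 / k^2\<close>.\<close>
    have "s k * v k = 2 * ((8 * L / 2 ^ k) powr (1/\<alpha>) * (1/8) powr (1/\<alpha>) * (2 ^ k) powr (1/\<alpha>)) * L powr (- ((1 - \<alpha>) / \<alpha>))"
      by (simp add: s_def v_def c_def L_def mult_ac)
    also have "(8 * L / 2 ^ k) powr (1/\<alpha>) * (1/8) powr (1/\<alpha>) * (2 ^ k) powr (1/\<alpha>) = L powr (1/\<alpha>)"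
      using L by (simp add: powr_mult[symmetric])
    also have "2 * L powr (1/\<alpha>) * L powr (- ((1 - \<alpha>) / \<alpha>)) = 2 * L powr (1/\<alpha> + - ((1 - \<alpha>) / \<alpha>))"
      by (simp only: powr_add mult.assoc)
    also have "1/\<alpha> + - ((1 - \<alpha>) / \<alpha>) = 1" using alpha by (simp add: field_simps)
    finally have sv: "s k * v k = 2 * L" using L by simp
    have "prob (E k) \<le> exp (s k * v k - real (card {0..(2^k::int)}) * s k powr \<alpha> / 2)"
      unfolding E_def using s by (intro sum_lower_tail) auto
    also have "\<dots> \<le> exp (s k * v k - 2 ^ k * s k powr \<alpha> / 2)"
    proof -
      have "2 ^ k \<le> real (card {0..(2^k::int)})" by (simp add: nat_add_distrib nat_power_eq)
      then have "2 ^ k * s k powr \<alpha> \<le> real (card {0..(2^k::int)}) * s k powr \<alpha>"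
        by (intro mult_right_mono) auto
      then show ?thesis by simp
    qed
    also have "s k * v k - 2 ^ k * s k powr \<alpha> / 2 = - (2 * L)"
      unfolding sv sa by simp
    also have "exp (- (2 * L)) = inverse (real k ^ 2)"
      using elim exp_of_nat_mult[of 2 L] by (simp add: L_def exp_minus)
    finally show ?case by simp
  qed
  then have "summable (\<lambda>k. prob (E k))"
    by (rule summable_comparison_test_ev) (rule inverse_power_summable, simp)
  then have "AE \<omega> in M. \<forall>\<^sub>F k in sequentially. \<omega> \<in> space M - E k"
    by (intro borel_cantelli_AE1) (auto simp: less_top[symmetric])
  then show ?thesis
    by eventually_elim (auto simp: E_def v_def elim: eventually_mono)
qed

text \<open>To find intervals of exceptionally small mass, \<open>[-R k, R k]\<close> is cut into about \<open>ln k\<close> shells of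
  width \<open>2 ^ k\<^sup>2\<close>, each of which carries a typical mass with probability at least 1/2; all of
  them do so with probability at least \<open>1 / (2 k)\<close>. The core that is left out of the shells makes
  the events at different \<open>k\<close> independent.\<close>

definition shells :: "nat \<Rightarrow> nat" where "shells k = Suc (nat \<lfloor>ln (real k)\<rfloor>)"

definition shell :: "nat \<Rightarrow> nat \<Rightarrow> int set" where
  "shell k i = {x. 2 ^ (k\<^sup>2 - k) < \<bar>x\<bar> \<and> int i * 2 ^ k\<^sup>2 < \<bar>x\<bar> \<and> \<bar>x\<bar> \<le> int (Suc i) * 2 ^ k\<^sup>2}"

text \<open>Chosen so that \<open>sum_tail\<close>, applied to at most
  \<open>2 * 2 ^ k\<^sup>2\<close> sites, yields at most 1/2; the \<open>+ 1\<close> keeps the level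
  at least 1.\<close>

definition mass_const :: real where "mass_const = (4 * tail_const + 1) powr (1/\<alpha>)"

lemma shells_le: "shells k \<le> 2 ^ k"
proof (cases "k = 0")
  case False
  have "ln (real k) \<le> real k - 1" using False by (intro ln_le_minus_one) auto
  then have "shells k \<le> k" using False unfolding shells_def by linarith
  also have "k \<le> 2 ^ k" by simp
  finally show ?thesis .
qed (simp add: shells_def)

text \<open>The exponent \<open>k\<^sup>2 - k\<close> of the core is made for this:
  \<open>k\<^sup>2 + k\<close> equals \<open>(Suc k)\<^sup>2 - Suc k\<close>, so all shells of index
  \<open>k\<close> end within the core of index \<open>k + 1\<close>.\<close>

lemma shell_subset:
  assumes "i < shells k" "x \<in> shell k i"
  shows "2 ^ (k\<^sup>2 - k) < \<bar>x\<bar>" "\<bar>x\<bar> \<le> 2 ^ ((Suc k)\<^sup>2 - Suc k)"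
proof -
  show "2 ^ (k\<^sup>2 - k) < \<bar>x\<bar>" using assms by (simp add: shell_def)
  have "Suc i \<le> 2 ^ k" using assms(1) shells_le[of k] by simp
  then have i: "int (Suc i) \<le> int (2 ^ k)" by (simp only: of_nat_le_iff)
  have "\<bar>x\<bar> \<le> int (Suc i) * 2 ^ k\<^sup>2" using assms by (simp add: shell_def)
  also have "\<dots> \<le> 2 ^ k * 2 ^ k\<^sup>2"
    using i by (intro mult_right_mono) auto
  also have "\<dots> = 2 ^ ((Suc k)\<^sup>2 - Suc k)"
    by (simp add: power2_eq_square flip: power_add)
  finally show "\<bar>x\<bar> \<le> 2 ^ ((Suc k)\<^sup>2 - Suc k)" .
qed

lemma finite_shell [simp]: "finite (shell k i)"
  by (rule finite_subset[of _ "{- (int (Suc i) * 2 ^ k\<^sup>2)..int (Suc i) * 2 ^ k\<^sup>2}"]) (auto simp: shell_def)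

lemma card_shell: "card (shell k i) \<le> 2 * 2 ^ k\<^sup>2"
proof -
  let ?a = "int i * 2 ^ k\<^sup>2" and ?b = "int (Suc i) * 2 ^ k\<^sup>2"
  have "card (shell k i) \<le> card ({?a<..?b} \<union> {-?b..<-?a})"
    by (intro card_mono) (auto simp: shell_def)
  also have "\<dots> \<le> card {?a<..?b} + card {-?b..<-?a}" by (rule card_Un_le)
  also have "\<dots> = 2 * 2 ^ k\<^sup>2" by (simp add: algebra_simps nat_power_eq)
  finally show ?thesis .
qed

lemma disjoint_shell: "disjoint_family_on (shell k) I"
proof -
  have "shell k i \<inter> shell k j = {}" if "i < j" for i j
  proof -
    have "int (Suc i) * 2 ^ k\<^sup>2 \<le> int j * 2 ^ k\<^sup>2" using that by (intro mult_right_mono) auto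
    moreover have "\<bar>x\<bar> \<le> int (Suc i) * 2 ^ k\<^sup>2 \<and> int j * 2 ^ k\<^sup>2 < \<bar>x\<bar>"
      if "x \<in> shell k i \<inter> shell k j" for x
      using that by (auto simp: shell_def)
    ultimately show ?thesis by (meson equals0I leD order.trans)
  qed
  then show ?thesis unfolding disjoint_family_on_def by (metis inf_commute linorder_neqE_nat)
qed

lemma prob_shell:
  "1/2 \<le> prob {\<omega> \<in> space M. S (shell k i) \<omega> \<le> mass_const * (2 ^ k\<^sup>2) powr (1/\<alpha>)}"
proof -
  let ?u = "mass_const * (2 ^ k\<^sup>2) powr (1/\<alpha>)"
  have "1 \<le> mass_const"
    unfolding mass_const_def using tail_const_pos alpha by (intro ge_one_powr_ge_zero) auto
  then have u: "1 \<le> ?u" using alpha by (intro mult_ge1_I ge_one_powr_ge_zero) auto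
  have "prob {\<omega> \<in> space M. S (shell k i) \<omega> > ?u} \<le> tail_const * real (card (shell k i)) * ?u powr (-\<alpha>)"
    using u by (intro sum_tail) auto
  also have "?u powr (-\<alpha>) = inverse ((4 * tail_const + 1) * 2 ^ k\<^sup>2)"
    using alpha tail_const_pos by (simp add: mass_const_def powr_mult powr_powr powr_minus field_simps)
  also have "tail_const * real (card (shell k i)) * inverse ((4 * tail_const + 1) * 2 ^ k\<^sup>2)
      \<le> tail_const * (2 * 2 ^ k\<^sup>2) * inverse ((4 * tail_const + 1) * 2 ^ k\<^sup>2)"
    using card_shell[of k i] tail_const_pos
    by (intro mult_right_mono mult_left_mono) (auto simp: of_nat_le_iff[symmetric, where 'a=real] simp del: of_nat_le_iff)
  also have "\<dots> = 2 * tail_const / (4 * tail_const + 1)"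
    by (simp add: divide_inverse)
  also have "\<dots> \<le> 1/2" using tail_const_pos by (simp add: field_simps)
  finally show ?thesis
    using prob_neg[of "\<lambda>\<omega>. S (shell k i) \<omega> > ?u"] by (simp add: not_less)
qed

lemma shells_io:
  "AE \<omega> in M. \<exists>\<^sub>F k in sequentially. \<forall>i<shells k. S (shell k i) \<omega> \<le> mass_const * (2 ^ k\<^sup>2) powr (1/\<alpha>)"
proof -
  define u where "u k = mass_const * (2 ^ k\<^sup>2) powr (1/\<alpha>)" for k :: nat
  define G where "G k \<omega> \<longleftrightarrow> (\<forall>i<shells k. S (shell k i) \<omega> \<le> u k)" for k \<omega>
  \<comment> \<open>Annuli between consecutive cores; they are disjoint and carry the independence
    in \<open>k\<close>.\<close>
  define A where "A k = {x::int. 2 ^ (k\<^sup>2 - k) < \<bar>x\<bar> \<and> \<bar>x\<bar> \<le> 2 ^ ((Suc k)\<^sup>2 - Suc k)}" for k :: nat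
  have sub: "shell k i \<subseteq> A k" if "i < shells k" for k i
    using shell_subset[OF that] by (auto simp: A_def)
  have disjA: "disjoint_family_on A UNIV"
  proof -
    have "A j \<inter> A k = {}" if "j < k" for j k
    proof -
      have "(Suc j)\<^sup>2 - Suc j \<le> k\<^sup>2 - k"
      proof -
        have "Suc j * (Suc j - 1) \<le> k * (k - 1)" using that by (intro mult_le_mono) auto
        then show ?thesis by (simp add: power2_eq_square right_diff_distrib')
      qed
      then have le: "(2::int) ^ ((Suc j)\<^sup>2 - Suc j) \<le> 2 ^ (k\<^sup>2 - k)" by (intro power_increasing) auto
      show ?thesis
      proof (rule equals0I)
        fix x assume "x \<in> A j \<inter> A k"
        then have "\<bar>x\<bar> \<le> 2 ^ ((Suc j)\<^sup>2 - Suc j)" "2 ^ (k\<^sup>2 - k) < \<bar>x\<bar>" unfolding A_def by blast+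
        with le show False by linarith
      qed
    qed
    then show ?thesis unfolding disjoint_family_on_def by (metis inf_commute linorder_neqE_nat)
  qed
  have restr: "(\<Sum>x\<in>B. restrict (\<tau> \<omega>) C x) = S B \<omega>" if "B \<subseteq> C" for B C \<omega>
    using that by (intro sum.cong) auto
  have meas: "(\<lambda>f. \<Sum>x\<in>B. f x :: real) \<in> borel_measurable (PiM C (\<lambda>_. borel))" if "B \<subseteq> C" for B C :: "int set"
    by (rule borel_measurable_sum[of B "\<lambda>x f. f x"])
       (rule measurable_component_singleton, use that in auto)
  have probG: "(1/2) ^ shells k \<le> prob {\<omega>\<in>space M. G k \<omega>}" for k
  proof -
    let ?E = "\<lambda>i. {\<omega> \<in> space M. S (shell k i) \<omega> \<le> u k}"
    have "indep_events ?E {..<shells k}"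
    proof (rule indep_events_blocks[where K = "shell k" and Q = "\<lambda>i f. (\<Sum>x\<in>shell k i. f x) \<le> u k"])
      show "{f \<in> space (PiM (shell k j) (\<lambda>_. borel)). (\<Sum>x\<in>shell k j. f x) \<le> u k} \<in> sets (PiM (shell k j) (\<lambda>_. borel))" for j
        using meas[of "shell k j" "shell k j"] by measurable
    qed (auto simp: disjoint_shell restr)
    then have "prob (\<Inter>i\<in>{..<shells k}. ?E i) = (\<Prod>i\<in>{..<shells k}. prob (?E i))"
      by (auto simp: indep_events_def shells_def)
    also have "\<dots> \<ge> (\<Prod>i\<in>{..<shells k}. 1/2)"
    proof (intro prod_mono conjI)
      show "1/2 \<le> prob (?E i)" for i unfolding u_def by (rule prob_shell)
    qed simp
    also have "(\<Inter>i\<in>{..<shells k}. ?E i) = {\<omega>\<in>space M. G k \<omega>}"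
      by (auto simp: G_def shells_def)
    finally show ?thesis by simp
  qed
  have "AE \<omega> in M. \<exists>\<^sub>F k in sequentially. \<omega> \<notin> {\<omega>\<in>space M. \<not> G k \<omega>}"
  proof (rule borel_cantelli_second)
    show "indep_events (\<lambda>k. {\<omega>\<in>space M. \<not> G k \<omega>}) UNIV"
    proof (rule indep_events_blocks[where K = A and Q = "\<lambda>k f. \<not> (\<forall>i<shells k. (\<Sum>x\<in>shell k i. f x) \<le> u k)"])
      show "{f \<in> space (PiM (A k) (\<lambda>_. borel)). \<not> (\<forall>i<shells k. (\<Sum>x\<in>shell k i. f x) \<le> u k)} \<in> sets (PiM (A k) (\<lambda>_. borel))" for k
      proof -
        have "{f \<in> space (PiM (A k) (\<lambda>_. borel)). \<not> (\<forall>i<shells k. (\<Sum>x\<in>shell k i. f x) \<le> u k)}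
          = (\<Union>i\<in>{..<shells k}. {f \<in> space (PiM (A k) (\<lambda>_. borel)). u k < (\<Sum>x\<in>shell k i. f x)})"
          by (auto simp: not_le)
        also have "\<dots> \<in> sets (PiM (A k) (\<lambda>_. borel))"
          using meas[OF sub] by (intro sets.finite_UN) auto
        finally show ?thesis .
      qed
      show "(\<not> (\<forall>i<shells k. (\<Sum>x\<in>shell k i. restrict (\<tau> \<omega>) (A k) x) \<le> u k)) \<longleftrightarrow> \<not> G k \<omega>" for k \<omega>
        unfolding G_def using restr[OF sub] by metis
    qed (rule disjA)
    have [measurable]: "{\<omega>\<in>space M. G k \<omega>} \<in> events" for k
      unfolding G_def by measurable
    have ge: "1/2 * (1 / real k) \<le> 1 - prob {\<omega>\<in>space M. \<not> G k \<omega>}" if "k \<ge> 1" for k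
    proof -
      have "1 - prob {\<omega>\<in>space M. \<not> G k \<omega>} = prob {\<omega>\<in>space M. G k \<omega>}"
        using prob_neg[of "G k"] \<open>{\<omega>\<in>space M. G k \<omega>} \<in> events\<close> by simp
      moreover have "1/2 * (1 / real k) \<le> (1/2) ^ shells k"
      proof -
        have l: "0 \<le> ln (real k)" using that by simp
        have "(2::real) ^ nat \<lfloor>ln (real k)\<rfloor> = 2 powr real (nat \<lfloor>ln (real k)\<rfloor>)" by (simp add: powr_realpow)
        also have "\<dots> \<le> 2 powr ln (real k)" using l by (intro powr_mono) auto
        also have "\<dots> \<le> exp 1 powr ln (real k)"
          using l exp_ge_add_one_self[of 1] by (intro powr_mono2) auto
        also have "\<dots> = real k" using that by (simp add: powr_def)
        finally have "1 / real k \<le> 1 / 2 ^ nat \<lfloor>ln (real k)\<rfloor>" using that by (intro divide_left_mono) auto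
        then show ?thesis by (simp add: shells_def power_one_over)
      qed
      ultimately show ?thesis using probG[of k] by linarith
    qed
    show "\<not> summable (\<lambda>k. 1 - prob {\<omega>\<in>space M. \<not> G k \<omega>})"
    proof
      assume "summable (\<lambda>k. 1 - prob {\<omega>\<in>space M. \<not> G k \<omega>})"
      then have "summable (\<lambda>k. 1/2 * (1 / real k))"
      proof (rule summable_comparison_test'[where N = 1])
        show "norm (1/2 * (1 / real k)) \<le> 1 - prob {\<omega>\<in>space M. \<not> G k \<omega>}" if "k \<ge> 1" for k
          using ge[OF that] by simp
      qed
      then have "summable (\<lambda>k. 2 * (1/2 * (1 / real k)))" by (rule summable_mult)
      moreover have "(\<lambda>k. 2 * (1/2 * (1 / real k))) = (\<lambda>k. inverse (real k))" by (auto simp: field_simps)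
      ultimately show False using not_summable_harmonic[where 'a=real] by (simp only:)
    qed
  qed
  then show ?thesis
    using AE_space
  proof eventually_elim
    case (elim \<omega>)
    from elim(1) show ?case
      by (rule frequently_elim1) (use elim(2) in \<open>auto simp: G_def u_def\<close>)
  qed
qed

text \<open>Puts the core back. By \<open>upper_growth\<close> its mass is at most
  \<open>(2 ^ (k\<^sup>2 - k) * k^4) powr (1/\<alpha>)\<close>, and \<open>k^4 < 2 ^ k\<close>
  eventually, so it weighs no more than one typical shell.\<close>

lemma small_mass_io:
  "AE \<omega> in M. \<exists>\<^sub>F k in sequentially.
     S {- int (shells k * 2 ^ k\<^sup>2)..int (shells k * 2 ^ k\<^sup>2)} \<omega>
       \<le> (mass_const + 1) * real (shells k) * (2 ^ k\<^sup>2) powr (1/\<alpha>)"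
  using shells_io upper_growth AE_traps
proof eventually_elim
  case (elim \<omega>)
  then interpret traps "\<tau> \<omega>" by simp
  have "filterlim (\<lambda>k. k\<^sup>2 - k) at_top (sequentially :: nat filter)"
  proof (rule filterlim_at_top_mono[OF filterlim_minus_const_nat_at_top[of 1]])
    show "\<forall>\<^sub>F k in sequentially. k - 1 \<le> k\<^sup>2 - k"
    proof (rule always_eventually, rule allI)
      fix k :: nat
      have "1 * (k - 1) \<le> k * (k - 1)" by (cases k) auto
      then show "k - 1 \<le> k\<^sup>2 - k" by (simp add: power2_eq_square right_diff_distrib')
    qed
  qed
  from eventually_compose_filterlim[OF elim(2) this]
  have inner: "\<forall>\<^sub>F k in sequentially. S {-(2^(k\<^sup>2-k))..2^(k\<^sup>2-k)} \<omega> \<le> (2 ^ (k\<^sup>2-k) * real (k\<^sup>2-k) ^ 2) powr (1/\<alpha>)" .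
  have "((\<lambda>k. real k ^ 4 / 2 ^ k) \<longlongrightarrow> 0) sequentially" by real_asymp
  then have "\<forall>\<^sub>F k in sequentially. real k ^ 4 / 2 ^ k < 1" by (rule order_tendstoD) simp
  with inner have "\<forall>\<^sub>F k in sequentially. S {-(2^(k\<^sup>2-k))..2^(k\<^sup>2-k)} \<omega> \<le> (2 ^ k\<^sup>2) powr (1/\<alpha>)"
  proof eventually_elim
    case (elim k)
    have "k \<le> k\<^sup>2" by (simp add: power2_eq_square)
    then have "(2::real) ^ k\<^sup>2 = 2 ^ (k\<^sup>2 - k) * 2 ^ k" by (simp flip: power_add)
    moreover have "real (k\<^sup>2-k) ^ 2 \<le> (real k ^ 2) ^ 2" by (intro power_mono) (auto simp flip: of_nat_power)
    then have "real (k\<^sup>2-k) ^ 2 \<le> 2 ^ k" using elim(2) by (simp add: field_simps)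
    ultimately have "2 ^ (k\<^sup>2-k) * real (k\<^sup>2-k) ^ 2 \<le> 2 ^ k\<^sup>2" by simp
    then have "(2 ^ (k\<^sup>2-k) * real (k\<^sup>2-k) ^ 2) powr (1/\<alpha>) \<le> (2 ^ k\<^sup>2) powr (1/\<alpha>)"
      using alpha by (intro powr_mono2) auto
    with elim(1) show ?case by linarith
  qed
  from frequently_eventually_frequently[OF elim(1) this]
  show ?case
  proof (rule frequently_elim1, safe)
    fix k
    let ?R = "int (shells k * 2 ^ k\<^sup>2)" and ?w = "(2 ^ k\<^sup>2) powr (1/\<alpha>)" and ?I = "{-(2^(k\<^sup>2-k))..2^(k\<^sup>2-k)} :: int set"
    assume shell: "\<forall>i<shells k. S (shell k i) \<omega> \<le> mass_const * ?w"
      and inner: "S ?I \<omega> \<le> ?w"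
    have cover: "{-?R..?R} \<subseteq> ?I \<union> (\<Union>i<shells k. shell k i)"
    proof
      fix x assume x: "x \<in> {-?R..?R}"
      show "x \<in> ?I \<union> (\<Union>i<shells k. shell k i)"
      proof (cases "x \<in> ?I")
        case False
        then have big: "2 ^ (k\<^sup>2 - k) < \<bar>x\<bar>" by auto
        have pos: "0 < \<bar>x\<bar>" using big zero_less_power[of "2::int" "k\<^sup>2 - k"] by linarith
        define J :: int where "J = 2 ^ k\<^sup>2"
        have J: "0 < J" by (simp add: J_def)
        \<comment> \<open>\<open>\<bar>x\<bar> - 1\<close>, because shells are open on the inside
          and closed on the outside.\<close>
        define i where "i = nat ((\<bar>x\<bar> - 1) div J)"
        have i: "int i = (\<bar>x\<bar> - 1) div J" unfolding i_def using J pos by (simp add: pos_imp_zdiv_nonneg_iff)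
        have dm: "\<bar>x\<bar> - 1 = int i * J + (\<bar>x\<bar> - 1) mod J" unfolding i by simp
        have m: "0 \<le> (\<bar>x\<bar> - 1) mod J" "(\<bar>x\<bar> - 1) mod J < J" using J by auto
        have "int i * J < \<bar>x\<bar>" "\<bar>x\<bar> \<le> int (Suc i) * J" using dm m by (auto simp: algebra_simps)
        then have "x \<in> shell k i" using big by (auto simp: shell_def J_def)
        moreover have "i < shells k"
        proof -
          have "\<bar>x\<bar> \<le> int (shells k) * J" using x by (auto simp: J_def)
          with \<open>int i * J < \<bar>x\<bar>\<close> have "int i * J < int (shells k) * J" by linarith
          then show ?thesis using J by simp
        qed
        ultimately show ?thesis by auto
      qed auto
    qed
    have "S {-?R..?R} \<omega> \<le> S (?I \<union> (\<Union>i<shells k. shell k i)) \<omega>"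
      by (intro sum_mono2 cover) auto
    also have "\<dots> \<le> S ?I \<omega> + S (\<Union>i<shells k. shell k i) \<omega>"
      by (subst sum_Un) (auto intro!: sum_nonneg)
    also have "S (\<Union>i<shells k. shell k i) \<omega> = (\<Sum>i<shells k. S (shell k i) \<omega>)"
      using disjoint_shell[of k "{..<shells k}"]
      by (intro sum.UNION_disjoint) (auto simp: disjoint_family_on_def)
    also have "S ?I \<omega> + (\<Sum>i<shells k. S (shell k i) \<omega>) \<le> S ?I \<omega> + (\<Sum>i<shells k. mass_const * ?w)"
      using shell by (intro add_left_mono sum_mono) auto
    also have "\<dots> = S ?I \<omega> + real (shells k) * mass_const * ?w" by simp
    also have "S ?I \<omega> + real (shells k) * mass_const * ?w \<le> 1 * ?w + real (shells k) * mass_const * ?w"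
      using inner by simp
    also have "\<dots> \<le> real (shells k) * ?w + real (shells k) * mass_const * ?w"
      by (intro add_right_mono mult_right_mono) (auto simp: shells_def)
    also have "\<dots> = (mass_const + 1) * real (shells k) * ?w" by (simp add: algebra_simps)
    finally show "S {-?R..?R} \<omega> \<le> (mass_const + 1) * real (shells k) * ?w" by simp
  qed
qed

section \<open>Asymptotics of the heat kernel\<close>

definition "\<gamma> = (1 - \<alpha>) / (1 + \<alpha>)"
definition "\<beta> = (1 - \<alpha>) / \<alpha>"
definition "\<psi> t = phi_alpha \<alpha> t * ln (ln t) powr \<gamma>"
text \<open>The spatial scale reached at time \<open>t\<close>; it balances \<open>1 / S {0..\<rho> t}\<close> against \<open>\<rho> t / t\<close>.\<close>
definition "\<rho> t = t * \<psi> t"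

lemma exponents: "0 < \<gamma>" "0 < \<beta>" "\<gamma> / \<alpha> = \<beta> - \<gamma>"
  using alpha by (simp_all add: \<gamma>_def \<beta>_def field_simps)

lemma psi_eq: "\<psi> t = t powr (- (1 / (1 + \<alpha>))) * ln (ln t) powr \<gamma>"
  by (simp add: \<psi>_def phi_alpha_def)

lemma rho_eq: "0 < t \<Longrightarrow> \<rho> t = t powr (\<alpha> / (1 + \<alpha>)) * ln (ln t) powr \<gamma>"
proof -
  assume t: "0 < t"
  have "t * t powr (- (1 / (1 + \<alpha>))) = t powr (1 + - (1 / (1 + \<alpha>)))"
    using t by (subst powr_add) simp
  also have "1 + - (1 / (1 + \<alpha>)) = \<alpha> / (1 + \<alpha>)" using alpha by (simp add: field_simps)
  finally show ?thesis by (simp add: \<rho>_def psi_eq)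
qed

lemma rho_powr:
  assumes "0 < t" "0 < ln (ln t)"
  shows "\<rho> t powr (1/\<alpha>) = t powr (1 / (1 + \<alpha>)) * ln (ln t) powr (\<gamma> / \<alpha>)"
  using assms alpha by (simp add: rho_eq powr_mult powr_powr)

text \<open>The almost sure lower bound for the mass at radius \<open>\<rho> t\<close> is of order
  \<open>1 / \<psi> t\<close>, while \<open>\<rho> t / t\<close> is \<open>\<psi> t\<close>: the
  balance that fixes the exponent \<gamma>.\<close>

lemma rho_psi:
  assumes "0 < t" "0 < ln (ln t)"
  shows "\<rho> t powr (1/\<alpha>) * ln (ln t) powr (-\<beta>) = 1 / \<psi> t"
proof -
  have "\<rho> t powr (1/\<alpha>) * ln (ln t) powr (-\<beta>) = t powr (1 / (1 + \<alpha>)) * ln (ln t) powr (\<gamma> / \<alpha> + - \<beta>)"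
    using assms by (simp only: rho_powr powr_add mult.assoc)
  also have "\<gamma> / \<alpha> + - \<beta> = - \<gamma>" using exponents by simp
  finally show ?thesis by (simp add: psi_eq powr_minus_divide)
qed

lemma psi_pos: "0 < t \<Longrightarrow> 0 < ln (ln t) \<Longrightarrow> 0 < \<psi> t"
  by (simp add: psi_eq)

lemma rho_filterlim: "filterlim \<rho> at_top at_top"
proof -
  define a where "a = \<alpha> / (1 + \<alpha>)"
  have "0 < a" using alpha by (simp add: a_def)
  moreover note exponents(1)
  ultimately have "filterlim (\<lambda>t. t powr a * ln (ln t) powr \<gamma>) at_top at_top" by real_asymp
  then show ?thesis
    by (rule filterlim_cong[OF refl refl, THEN iffD1, rotated])
       (auto intro: eventually_mono[OF eventually_gt_at_top[of 0]] simp: rho_eq a_def)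
qed

lemma psi_tendsto_0: "(\<psi> \<longlongrightarrow> 0) at_top"
proof -
  define a where "a = 1 / (1 + \<alpha>)"
  have "0 < a" using alpha by (simp add: a_def)
  moreover note exponents(1)
  ultimately have "((\<lambda>t. t powr (- a) * ln (ln t) powr \<gamma>) \<longlongrightarrow> 0) at_top" by real_asymp
  then show ?thesis by (simp add: psi_eq[abs_def] a_def)
qed

lemma eventually_lnln: "\<forall>\<^sub>F t in at_top. (1::real) < t \<and> 1 \<le> ln t \<and> 1 \<le> ln (ln t)"
  by (intro eventually_conj eventually_gt_at_top) real_asymp+

section \<open>Two-sided kernel bounds at the spatial scale\<close>

definition "lower_const = 2 * (1/8) powr (1/\<alpha>)"
text \<open>The factor \<open>2 powr \<beta>\<close> pays for replacing \<open>ln k\<close> by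
  \<open>2 * ln (ln t)\<close>.\<close>

definition "C1 = 2 powr \<beta> / lower_const"
text \<open>Makes \<open>C2 * \<rho> t\<close> dominate \<open>n / V + 4 * r\<close> when
  \<open>n \<le> 3 * t\<close>, \<open>1 / V \<le> C1 * \<psi> t\<close> and
  \<open>r \<le> 2 * \<rho> t\<close>.\<close>

definition "C2 = 3 * C1 + 8"

lemma lower_const_pos: "0 < lower_const" by (simp add: lower_const_def)
lemma C1_pos: "0 < C1" using lower_const_pos by (simp add: C1_def)
lemma C2_ge: "1 \<le> C2" using C1_pos by (simp add: C2_def)

definition good :: "'w \<Rightarrow> bool" where
  "good \<omega> \<longleftrightarrow> traps (\<tau> \<omega>) \<and> (\<forall>\<^sub>F k in sequentially.
     lower_const * (2 ^ k) powr (1/\<alpha>) * ln (real k) powr (-\<beta>) \<le> S {0..2^k} \<omega>)"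

lemma AE_good: "AE \<omega> in M. good \<omega>"
  using AE_traps lower_growth
  by eventually_elim (simp add: good_def lower_const_def \<beta>_def)

text \<open>The radius is the power \<open>2 ^ k\<close> between \<open>\<rho> t\<close> and
  \<open>2 * \<rho> t\<close>. Since \<open>\<psi> t < 1/2\<close> it is at most \<open>t\<close>,
  so \<open>k\<close> is at most \<open>2 * ln t\<close>, which gives the comparison of
  \<open>ln k\<close> with \<open>ln (ln t)\<close>.\<close>

lemma mass_at_scale:
  assumes "good \<omega>"
  shows "\<forall>\<^sub>F t in at_top. \<exists>r::nat. 1 / S {0..int r} \<omega> \<le> C1 * \<psi> t \<and> real r \<le> 2 * \<rho> t"
proof -
  from assms interpret traps "\<tau> \<omega>" by (simp add: good_def)
  obtain k0 where k0: "\<And>k. k0 \<le> k \<Longrightarrow> lower_const * (2 ^ k) powr (1/\<alpha>) * ln (real k) powr (-\<beta>) \<le> S {0..2^k} \<omega>"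
    using assms by (auto simp: good_def eventually_sequentially)
  have "\<forall>\<^sub>F t in at_top. 2 ^ max 2 k0 \<le> \<rho> t"
    using rho_filterlim by (simp only: filterlim_at_top) 
  moreover have "\<forall>\<^sub>F t in at_top. \<psi> t < 1/2"
    by (rule order_tendstoD[OF psi_tendsto_0]) simp
  moreover have "\<forall>\<^sub>F t::real in at_top. 2 * ln t \<le> (ln t)\<^sup>2" by real_asymp
  ultimately show ?thesis using eventually_lnln
  proof eventually_elim
    case (elim t)
    have "(1::real) \<le> 2 ^ max 2 k0" by simp
    with elim have t: "0 < t" "0 < ln (ln t)" "1 \<le> \<rho> t" "0 < ln t" by linarith+
    obtain k where k: "\<rho> t \<le> 2 ^ k" "2 ^ k \<le> 2 * \<rho> t" using dyadic_above[OF t(3)] by metis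
    have "(2::real) ^ max 2 k0 \<le> 2 ^ k" using elim k by linarith
    then have kk: "k0 \<le> k" "2 \<le> k" by (auto simp: power_increasing_iff)
    have "\<rho> t \<le> t * (1/2)" unfolding \<rho>_def using elim t by (intro mult_left_mono) auto
    then have "2 ^ k \<le> t" using k by linarith
    then have "real k \<le> (ln t)\<^sup>2" using exponent_le_ln[of k t] elim by linarith
    then have "ln (real k) \<le> ln ((ln t)\<^sup>2)" using kk by (subst ln_le_cancel_iff) auto
    also have "\<dots> = 2 * ln (ln t)" using t by (simp add: ln_realpow)
    finally have lnk: "ln (real k) \<le> 2 * ln (ln t)" .
    have "(2 * ln (ln t)) powr (-\<beta>) \<le> ln (real k) powr (-\<beta>)"
      using lnk kk exponents(2) by (intro powr_mono2') auto
    moreover have "\<rho> t powr (1/\<alpha>) \<le> (2 ^ k) powr (1/\<alpha>)"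
      using k t alpha by (intro powr_mono2) auto
    ultimately have "lower_const * \<rho> t powr (1/\<alpha>) * (2 * ln (ln t)) powr (-\<beta>)
        \<le> lower_const * (2 ^ k) powr (1/\<alpha>) * ln (real k) powr (-\<beta>)"
      using lower_const_pos by (intro mult_mono) auto
    also have "\<dots> \<le> S {0..2^k} \<omega>" by (rule k0) fact
    also have "lower_const * \<rho> t powr (1/\<alpha>) * (2 * ln (ln t)) powr (-\<beta>)
        = lower_const * 2 powr (-\<beta>) * (\<rho> t powr (1/\<alpha>) * ln (ln t) powr (-\<beta>))"
      using t by (simp add: powr_mult mult_ac)
    also have "\<dots> = 1 / (C1 * \<psi> t)"
      unfolding rho_psi[OF t(1,2)] by (simp add: C1_def powr_minus field_simps)
    finally have "1 / (C1 * \<psi> t) \<le> S {0..2^k} \<omega>" .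
    moreover have "0 < C1 * \<psi> t" using C1_pos psi_pos t by simp
    ultimately have "1 / S {0..2^k} \<omega> \<le> C1 * \<psi> t"
      by (smt (verit) divide_le_eq le_divide_eq mult.commute zero_less_divide_1_iff)
    then show ?case using k by (intro exI[of _ "2 ^ k"]) simp
  qed
qed

lemma kernel_upper:
  assumes "good \<omega>"
  shows "\<forall>\<^sub>F t in at_top. heat_kernel (\<tau> \<omega>) t 0 0 \<le> (C1 + 4) * \<psi> t"
  using mass_at_scale[OF assms] eventually_gt_at_top[of 0]
proof eventually_elim
  case (elim t)
  from assms interpret traps "\<tau> \<omega>" by (simp add: good_def)
  obtain r :: nat where r: "1 / S {0..int r} \<omega> \<le> C1 * \<psi> t" "real r \<le> 2 * \<rho> t" using elim by auto
  have "heat_kernel (\<tau> \<omega>) t 0 0 = pois_kernel (\<tau> \<omega>) t 0" using elim by (intro heat_kernel_eq) auto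
  also have "\<dots> \<le> 1 / S {0..int r} \<omega> + 2 * real r / t" using elim by (intro pois_kernel_upper)
  also have "\<dots> \<le> C1 * \<psi> t + 4 * \<psi> t"
    using r elim by (intro add_mono) (auto simp: \<rho>_def divide_le_eq mult_ac)
  finally show ?case by (simp add: algebra_simps)
qed

text \<open>Every admissible \<open>R\<close> is kept, uniformly in \<open>t\<close>: the limsup
  uses an exceptional radius, the liminf a dyadic one.\<close>

lemma kernel_lower:
  assumes "good \<omega>"
  shows "\<forall>\<^sub>F t in at_top. \<forall>R::nat. C2 * \<rho> t \<le> real R \<longrightarrow>
     1 / (8 * S {-int R..int R} \<omega>) \<le> heat_kernel (\<tau> \<omega>) t 0 0"
  using mass_at_scale[OF assms] eventually_lnln
proof eventually_elim
  case (elim t)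
  then have "0 < ln (ln t)" by linarith
  with elim have t: "1 \<le> t" "0 < \<psi> t" using psi_pos[of t] by auto
  from assms interpret traps "\<tau> \<omega>" by (simp add: good_def)
  obtain r :: nat where r: "1 / S {0..int r} \<omega> \<le> C1 * \<psi> t" "real r \<le> 2 * \<rho> t" using elim by auto
  \<comment> \<open>At least the Poisson mean \<open>2 * t\<close>, and at most \<open>3 * t\<close>
    because \<open>t \<ge> 1\<close>.\<close>
  define n where "n = nat \<lceil>2 * t\<rceil>"
  have n: "2 * t \<le> real n" "real n \<le> 3 * t" unfolding n_def using t by linarith+
  show ?case
  proof (intro allI impI)
    fix R :: nat assume R: "C2 * \<rho> t \<le> real R"
    have rho: "0 < \<rho> t" using t by (simp add: \<rho>_def)
    have "0 < C2 * \<rho> t" using rho C2_ge by (intro mult_pos_pos) auto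
    then have "0 < R" using R by (metis of_nat_0_less_iff order_less_le_trans)
    have "real n * (1 / S {0..int r} \<omega>) \<le> (3 * t) * (C1 * \<psi> t)"
      using n r t C1_pos by (intro mult_mono) (auto intro!: divide_nonneg_nonneg sum_nonneg)
    then have "real n / S {0..int r} \<omega> + 4 * real r \<le> C2 * \<rho> t"
      using r(2) by (simp add: \<rho>_def C2_def algebra_simps)
    then have "1 / (8 * S {-int R..int R} \<omega>) \<le> pois_kernel (\<tau> \<omega>) t 0"
      using t n R \<open>0 < R\<close> by (intro pois_kernel_lower[of t n R r]) auto
    also have "\<dots> = heat_kernel (\<tau> \<omega>) t 0 0" using t by (intro heat_kernel_eq[symmetric]) auto
    finally show "1 / (8 * S {-int R..int R} \<omega>) \<le> heat_kernel (\<tau> \<omega>) t 0 0" .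
  qed
qed

section \<open>The limsup and the two liminfs\<close>

lemma limsup_finite:
  "AE \<omega> in M. Limsup at_top (\<lambda>t. ereal (heat_kernel (\<tau> \<omega>) t 0 0 / \<psi> t)) < \<infinity>"
  using AE_good
proof eventually_elim
  case (elim \<omega>)
  have "\<forall>\<^sub>F t in at_top. ereal (heat_kernel (\<tau> \<omega>) t 0 0 / \<psi> t) \<le> ereal (C1 + 4)"
    using kernel_upper[OF elim] eventually_lnln
  proof eventually_elim
    case (elim t)
    then have "0 < \<psi> t" by (intro psi_pos) linarith+
    with elim show ?case by (simp add: divide_le_eq)
  qed
  then have "Limsup at_top (\<lambda>t. ereal (heat_kernel (\<tau> \<omega>) t 0 0 / \<psi> t)) \<le> ereal (C1 + 4)"
    by (rule Limsup_bounded)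
  then show ?case by (rule order.strict_trans1) simp
qed

lemma rho_lower: "1 \<le> t \<Longrightarrow> 1 \<le> ln (ln t) \<Longrightarrow> t powr (\<alpha> / (1 + \<alpha>)) \<le> \<rho> t"
  using exponents(1) ge_one_powr_ge_zero[of "ln (ln t)" \<gamma>]
  by (simp add: rho_eq mult_le_cancel_left1)

lemma rho_continuous:
  assumes "\<And>t. t \<in> A \<Longrightarrow> 1 < t \<and> 1 \<le> ln t \<and> 1 \<le> ln (ln t)"
  shows "continuous_on A (\<lambda>t. C2 * \<rho> t)"
  unfolding \<rho>_def psi_eq
  by (intro continuous_intros ballI) (use assms in force)+

text \<open>A radius of about \<open>2 ^ k\<^sup>2\<close> makes \<open>ln t\<close> of order
  \<open>k^2\<close>; the lower bound on \<open>k\<close> absorbs the constant, so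
  \<open>ln t \<le> k^3\<close>, and the number of shells exceeds \<open>ln k\<close>.\<close>

lemma lnln_le_shells:
  assumes t: "1 \<le> t" "1 \<le> ln (ln t)" and lnt: "0 < ln t" and k: "1 \<le> k" "2 * (1 + \<alpha>) / \<alpha> \<le> real k"
    and scale: "\<rho> t \<le> real (shells k * 2 ^ k\<^sup>2)"
  shows "ln (ln t) \<le> 3 * real (shells k)"
proof -
  have "t powr (\<alpha> / (1 + \<alpha>)) \<le> real (shells k * 2 ^ k\<^sup>2)"
    using rho_lower[OF t] scale by linarith
  also have "\<dots> \<le> real (2 ^ k * 2 ^ k\<^sup>2)"
    using shells_le[of k] by (subst of_nat_le_iff) (rule mult_right_mono, auto)
  also have "\<dots> = 2 ^ (k + k\<^sup>2)" by (simp add: power_add)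
  also have "\<dots> \<le> (2::real) ^ (2 * k\<^sup>2)"
    by (intro power_increasing) (auto simp: power2_eq_square)
  finally have "ln (t powr (\<alpha> / (1 + \<alpha>))) \<le> ln (2 ^ (2 * k\<^sup>2))"
    using t by (subst ln_le_cancel_iff) auto
  then have "\<alpha> / (1 + \<alpha>) * ln t \<le> 2 * (real k)\<^sup>2 * ln 2"
    using t by (simp add: ln_powr ln_realpow)
  also have "\<dots> \<le> 2 * (real k)\<^sup>2 * 1"
    using ln_le_minus_one[of 2] by (intro mult_left_mono) auto
  finally have "ln t \<le> 2 * (1 + \<alpha>) / \<alpha> * (real k)\<^sup>2"
    using alpha by (simp add: field_simps)
  also have "\<dots> \<le> real k * (real k)\<^sup>2" using k(2) by (rule mult_right_mono) simp
  finally have "ln t \<le> real k ^ 3" by (simp add: power2_eq_square power3_eq_cube)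
  then have "ln (ln t) \<le> ln (real k ^ 3)" using lnt k by (subst ln_le_cancel_iff) auto
  also have "\<dots> = 3 * ln (real k)" using k by (simp add: ln_realpow)
  also have "ln (real k) \<le> real (shells k)"
    using k unfolding shells_def by linarith
  finally show ?thesis by simp
qed

lemma limsup_positive:
  "AE \<omega> in M. 0 < Limsup at_top (\<lambda>t. ereal (heat_kernel (\<tau> \<omega>) t 0 0 / \<psi> t))"
  using AE_good small_mass_io
proof eventually_elim
  case (elim \<omega>)
  from elim(1) interpret traps "\<tau> \<omega>" by (simp add: good_def)
  define R where "R k = shells k * 2 ^ k\<^sup>2" for k
  define C3 where "C3 = mass_const + 1"
  have mass_pos: "0 < C3" by (simp add: C3_def mass_const_def add_nonneg_pos)
  define \<delta> where "\<delta> = 1 / (8 * (C3 * 3 powr \<beta> * C2 powr (1/\<alpha>)))"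
  have d: "0 < \<delta>" using mass_pos C2_ge by (simp add: \<delta>_def)
  have "\<exists>t\<ge>T0. \<delta> \<le> heat_kernel (\<tau> \<omega>) t 0 0 / \<psi> t" for T0
  proof -
    obtain T where T: "max T0 2 \<le> T" and
      Tprop: "\<And>t. T \<le> t \<Longrightarrow> (1 < t \<and> 1 \<le> ln t \<and> 1 \<le> ln (ln t)) \<and>
        (\<forall>R::nat. C2 * \<rho> t \<le> real R \<longrightarrow> 1 / (8 * S {-int R..int R} \<omega>) \<le> heat_kernel (\<tau> \<omega>) t 0 0)"
      using eventually_conj[OF eventually_ge_at_top[of "max T0 2"] eventually_conj[OF eventually_lnln kernel_lower[OF elim(1)]]]
      unfolding eventually_at_top_linorder by (metis order_refl)
    \<comment> \<open>Ensures \<open>C2 * \<rho> T \<le> R k\<close>, so that a fitting time exists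
      beyond \<open>T\<close>, and the size condition of \<open>lnln_le_shells\<close>.\<close>
    define k0 where "k0 = nat \<lceil>max (max 1 (C2 * \<rho> T)) (2 * (1 + \<alpha>) / \<alpha>)\<rceil>"
    obtain k where k: "k0 \<le> k" and Sk: "S {- int (R k)..int (R k)} \<omega> \<le> C3 * real (shells k) * (2 ^ k\<^sup>2) powr (1/\<alpha>)"
      using elim(2) unfolding frequently_sequentially R_def C3_def by blast
    have kb: "1 \<le> real k" "C2 * \<rho> T \<le> real k" "2 * (1 + \<alpha>) / \<alpha> \<le> real k"
      using k unfolding k0_def by linarith+
    have "k \<le> R k"
    proof -
      have "k < 2 ^ k" by (rule less_exp)
      also have "(2::nat) ^ k \<le> 2 ^ k\<^sup>2" by (intro power_increasing) (auto simp: power2_eq_square)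
      also have "\<dots> \<le> R k" by (simp add: R_def shells_def)
      finally show ?thesis by simp
    qed
    then have RT: "C2 * \<rho> T \<le> real (R k)" using kb(2) by linarith
    have "\<forall>\<^sub>F t in at_top. real (R k) \<le> \<rho> t \<and> T \<le> t"
      using rho_filterlim by (intro eventually_conj eventually_ge_at_top) (simp only: filterlim_at_top)
    then obtain T' where T': "real (R k) \<le> \<rho> T'" "T \<le> T'"
      using eventually_happens[of _ "at_top :: real filter"] by force
    have "real (R k) \<le> C2 * \<rho> T'"
      using T'(1) C2_ge mult_right_mono[of 1 C2 "\<rho> T'"] by (smt (verit) of_nat_0_le_iff)
    \<comment> \<open>The exceptional radius is given first; the intermediate value theorem supplies
      a time whose scale is exactly that radius.\<close>
    then obtain t where t: "T \<le> t" "t \<le> T'" "C2 * \<rho> t = real (R k)"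
      using IVT'[of "\<lambda>t. C2 * \<rho> t" T "real (R k)" T', OF RT _ T'(2) rho_continuous] Tprop by auto
    have tp: "1 \<le> t" "1 \<le> ln (ln t)" and lnt: "0 < ln t" using Tprop[OF t(1)] by auto
    have t0: "0 < t" "0 < ln (ln t)" using tp by auto
    have psi: "0 < \<psi> t" using psi_pos[OF t0] .
    have rho: "0 < \<rho> t" using psi t0 by (simp add: \<rho>_def)
    have m: "ln (ln t) \<le> 3 * real (shells k)"
    proof (rule lnln_le_shells[OF tp lnt])
      have "\<rho> t \<le> C2 * \<rho> t" using C2_ge rho by simp
      then show "\<rho> t \<le> real (shells k * 2 ^ k\<^sup>2)" using t(3) by (simp add: R_def)
    qed (use kb in auto)
    have m1: "1 \<le> real (shells k)" by (simp add: shells_def)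
    \<comment> \<open>With \<open>m\<close> shells the mass is of order \<open>m * (R / m) powr
      (1/\<alpha>) = R powr (1/\<alpha>) * m powr (-\<beta>)\<close>, and \<open>m\<close> is at
      least \<open>ln (ln t) / 3\<close>: this is where the log-log gain arises.\<close>
    have J: "(2 ^ k\<^sup>2 :: real) = C2 * \<rho> t / real (shells k)"
      unfolding t(3) R_def using m1 by simp
    have "real (shells k) * (2 ^ k\<^sup>2) powr (1/\<alpha>) = (C2 * \<rho> t) powr (1/\<alpha>) * (real (shells k) powr 1 * real (shells k) powr (- (1/\<alpha>)))"
      unfolding J using C2_ge rho m1 by (simp add: powr_divide powr_minus field_simps)
    also have "real (shells k) powr 1 * real (shells k) powr (- (1/\<alpha>)) = real (shells k) powr (-\<beta>)"
    proof -
      have "1 + - (1/\<alpha>) = -\<beta>" using alpha by (simp add: \<beta>_def field_simps)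
      then show ?thesis by (simp only: powr_add[symmetric])
    qed
    also have "(C2 * \<rho> t) powr (1/\<alpha>) * real (shells k) powr (-\<beta>)
        \<le> (C2 * \<rho> t) powr (1/\<alpha>) * (3 powr \<beta> * ln (ln t) powr (-\<beta>))"
    proof (rule mult_left_mono)
      have "real (shells k) powr (-\<beta>) \<le> (ln (ln t) / 3) powr (-\<beta>)"
        using m t0 exponents(2) by (intro powr_mono2') auto
      also have "\<dots> = 3 powr \<beta> * ln (ln t) powr (-\<beta>)"
      proof -
        have "(ln (ln t) / 3) powr (-\<beta>) = ln (ln t) powr (-\<beta>) / 3 powr (-\<beta>)"
          by (rule powr_divide)
        also have "\<dots> = ln (ln t) powr (-\<beta>) * 3 powr \<beta>"
          by (simp only: powr_minus[of 3 \<beta>] divide_inverse inverse_inverse_eq)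
        also have "\<dots> = 3 powr \<beta> * ln (ln t) powr (-\<beta>)" by (rule mult.commute)
        finally show ?thesis .
      qed
      finally show "real (shells k) powr (-\<beta>) \<le> 3 powr \<beta> * ln (ln t) powr (-\<beta>)" .
    qed simp
    also have "\<dots> = 3 powr \<beta> * C2 powr (1/\<alpha>) * (\<rho> t powr (1/\<alpha>) * ln (ln t) powr (-\<beta>))"
      by (simp only: powr_mult mult_ac)
    also have "\<dots> = 3 powr \<beta> * C2 powr (1/\<alpha>) * (1 / \<psi> t)"
      by (simp only: rho_psi[OF t0])
    finally have "C3 * (real (shells k) * (2 ^ k\<^sup>2) powr (1/\<alpha>)) \<le> C3 * (3 powr \<beta> * C2 powr (1/\<alpha>) * (1 / \<psi> t))"
      using mass_pos by (intro mult_left_mono) auto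
    with Sk have "8 * S {- int (R k)..int (R k)} \<omega> \<le> 1 / (\<delta> * \<psi> t)"
      by (simp add: \<delta>_def mult.assoc)
    moreover have "0 < S {- int (R k)..int (R k)} \<omega>" by (intro sum_pos) auto
    ultimately have "1 / (1 / (\<delta> * \<psi> t)) \<le> 1 / (8 * S {- int (R k)..int (R k)} \<omega>)"
      using d psi by (intro divide_left_mono) auto
    also have "\<dots> \<le> heat_kernel (\<tau> \<omega>) t 0 0" using Tprop[OF t(1)] t(3) by simp
    finally have "\<delta> \<le> heat_kernel (\<tau> \<omega>) t 0 0 / \<psi> t" using psi by (simp add: field_simps)
    then show ?thesis using t T by (intro exI[of _ t]) auto
  qed
  then have fr: "\<exists>\<^sub>F t in at_top. \<delta> \<le> heat_kernel (\<tau> \<omega>) t 0 0 / \<psi> t"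
    by (auto simp: frequently_def eventually_at_top_linorder)
  have "ereal \<delta> \<le> Limsup at_top (\<lambda>t. ereal (heat_kernel (\<tau> \<omega>) t 0 0 / \<psi> t))"
  proof (rule ccontr)
    assume "\<not> ?thesis"
    then have "\<forall>\<^sub>F t in at_top. ereal (heat_kernel (\<tau> \<omega>) t 0 0 / \<psi> t) < ereal \<delta>"
      by (intro Limsup_lessD) simp
    with fr show False by (auto simp: frequently_def not_le elim: eventually_mono)
  qed
  then show ?case using d by (metis ereal_less(2) order_less_le_trans)
qed

text \<open>At \<open>t = n * v n\<close> the deep trap gives a kernel of at most
  \<open>3 / v n\<close>. As \<open>1 - a = \<alpha> * a\<close>, all powers of \<open>n\<close> and
  of its logarithm cancel and a multiple of \<open>K powr (- (\<alpha> * a))\<close> remains, with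
  \<open>K\<close> arbitrary.\<close>

lemma liminf_zero:
  "AE \<omega> in M. Liminf at_top (\<lambda>t. ereal (heat_kernel (\<tau> \<omega>) t 0 0 * ln t powr (1 / (1 + \<alpha>)) / phi_alpha \<alpha> t)) = 0"
proof -
  have "AE \<omega> in M. \<forall>K::nat. \<exists>\<^sub>F n in sequentially. \<tau> \<omega> (int n) > real (Suc K) * (real n * ln (real n)) powr (1/\<alpha>)"
    using big_trap by (subst AE_all_countable) simp
  with AE_traps show ?thesis
  proof eventually_elim
    case (elim \<omega>)
    then interpret traps "\<tau> \<omega>" by simp
    define a where "a = 1 / (1 + \<alpha>)"
    have a: "0 < a" "1 - a = \<alpha> * a" using alpha by (simp_all add: a_def field_simps)
    define f where "f t = heat_kernel (\<tau> \<omega>) t 0 0 * ln t powr a / phi_alpha \<alpha> t" for t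
    have hk: "0 \<le> heat_kernel (\<tau> \<omega>) t 0 0" if "0 \<le> t" for t
      using that by (simp add: heat_kernel_eq pois_kernel_nonneg)
    have small: "\<exists>\<^sub>F t in at_top. f t \<le> \<epsilon>" if \<epsilon>: "0 < \<epsilon>" for \<epsilon>
    proof -
      \<comment> \<open>From \<open>ln t = L + ln K + (L + ln L) / \<alpha>\<close>, where
        \<open>ln K\<close> and \<open>ln L\<close> are at most \<open>L\<close>.\<close>
      define D where "D = 2 + 2 / \<alpha>"
      have D: "0 < D" using alpha by (simp add: D_def add_pos_pos)
      have "((\<lambda>K. 3 * D powr a * real (Suc K) powr (- (\<alpha> * a))) \<longlongrightarrow> 0) sequentially"
      proof -
        have "0 < \<alpha> * a" using alpha a by simp
        then show ?thesis using D by real_asymp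
      qed
      then have "\<forall>\<^sub>F K in sequentially. 3 * D powr a * real (Suc K) powr (- (\<alpha> * a)) < \<epsilon>"
        using \<epsilon> by (rule order_tendstoD)
      then obtain N where N: "3 * D powr a * real (Suc N) powr (- (\<alpha> * a)) < \<epsilon>"
        by (auto simp: eventually_sequentially)
      define K where "K = real (Suc N)"
      have K: "1 \<le> K" by (simp add: K_def)
      define v where "v n = K * (real n * ln (real n)) powr (1/\<alpha>)" for n
      have "\<exists>t\<ge>T0. f t \<le> \<epsilon>" for T0
      proof -
        define n0 where "n0 = nat \<lceil>max (max 3 K) T0\<rceil>"
        obtain n where n: "n0 \<le> n" "\<tau> \<omega> (int n) > v n"
          using elim(2) unfolding frequently_sequentially v_def K_def by blast
        have nb: "3 \<le> real n" "K \<le> real n" "T0 \<le> real n" using n(1) unfolding n0_def by linarith+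
        define L where "L = ln (real n)"
        have e3: "exp 1 \<le> (3::real)" by (rule exp_le)
        have "ln (exp 1) \<le> ln (real n)" using e3 nb by (subst ln_le_cancel_iff) auto
        then have L: "1 \<le> L" by (simp add: L_def)
        have Ln: "L \<le> real n" unfolding L_def using nb ln_le_minus_one[of "real n"] by simp
        have nL: "1 \<le> real n * L" using nb L by (intro mult_ge1_I) auto
        have "1 \<le> (real n * L) powr (1/\<alpha>)" using nL alpha by (intro ge_one_powr_ge_zero) auto
        with K have v1: "1 \<le> v n" unfolding v_def L_def[symmetric] by (rule mult_ge1_I)
        define t where "t = real n * v n"
        have tn: "real n \<le> t" using v1 nb by (simp add: t_def mult_le_cancel_left1)
        then have t: "0 < t" "1 \<le> t" using nb by auto
        have "ln t = L + (ln K + (1/\<alpha>) * (L + ln L))"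
        proof -
          have "ln (v n) = ln K + ln ((real n * L) powr (1/\<alpha>))"
            unfolding v_def L_def[symmetric] using K nL by (subst ln_mult) auto
          also have "ln ((real n * L) powr (1/\<alpha>)) = (1/\<alpha>) * ln (real n * L)"
            using nL by (simp add: ln_powr)
          also have "ln (real n * L) = L + ln L" using nb L by (simp add: ln_mult L_def)
          finally show ?thesis unfolding t_def using nb v1 by (simp add: ln_mult L_def)
        qed
        also have "\<dots> \<le> L + (L + (1/\<alpha>) * (L + L))"
        proof (intro add_mono mult_left_mono order_refl)
          show "ln K \<le> L" unfolding L_def using K nb by (subst ln_le_cancel_iff) auto
          show "ln L \<le> L" using ln_le_minus_one[of L] L by simp
        qed (use alpha in auto)
        also have "\<dots> = D * L" by (simp add: D_def field_simps)
        finally have lnt: "ln t \<le> D * L" .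
        have "heat_kernel (\<tau> \<omega>) t 0 0 \<le> 1 / S {0..int n} \<omega> + 2 * real n / t"
          using t by (simp add: heat_kernel_eq pois_kernel_upper)
        also have "S {0..int n} \<omega> \<ge> v n"
          using n(2) member_le_sum[of "int n" "{0..int n}" "\<tau> \<omega>"] by simp
        then have "1 / S {0..int n} \<omega> \<le> 1 / v n" using v1 by (intro divide_left_mono mult_pos_pos) auto
        also have "1 / v n + 2 * real n / t = 3 / v n" using nb v1 by (simp add: t_def field_simps)
        finally have hk3: "heat_kernel (\<tau> \<omega>) t 0 0 \<le> 3 / v n" by simp
        have phi: "phi_alpha \<alpha> t = t powr (-a)" by (simp add: phi_alpha_def a_def)
        have "f t = heat_kernel (\<tau> \<omega>) t 0 0 * (ln t powr a * t powr a)"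
          unfolding f_def phi by (simp add: powr_minus divide_inverse mult_ac)
        also have "\<dots> \<le> 3 / v n * ((D * L) powr a * t powr a)"
          using hk3 lnt a t v1 hk[of t] by (intro mult_mono powr_mono2) auto
        also have "t powr a = real n powr a * v n powr a" unfolding t_def using nb v1 by (simp add: powr_mult)
        also have "3 / v n * ((D * L) powr a * (real n powr a * v n powr a))
            = 3 * D powr a * (real n * L) powr a * (v n powr a * v n powr (-1))"
          using D L nb v1 by (simp add: powr_mult powr_minus field_simps)
        also have "v n powr a * v n powr (-1) = v n powr (- (\<alpha> * a))"
        proof -
          have "a + -1 = - (\<alpha> * a)" using a(2) by simp
          then show ?thesis by (simp only: powr_add[symmetric])
        qed
        also have "v n powr (- (\<alpha> * a)) = K powr (- (\<alpha> * a)) * (real n * L) powr (-a)"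
          unfolding v_def L_def[symmetric] using K nL alpha by (simp add: powr_mult powr_powr)
        also have "3 * D powr a * (real n * L) powr a * (K powr (- (\<alpha> * a)) * (real n * L) powr (-a))
            = 3 * D powr a * K powr (- (\<alpha> * a)) * ((real n * L) powr a * (real n * L) powr (-a))"
          by (simp only: mult_ac)
        also have "(real n * L) powr a * (real n * L) powr (-a) = 1"
          unfolding powr_add[symmetric] using nb L by simp
        also have "3 * D powr a * K powr (- (\<alpha> * a)) * 1 = 3 * D powr a * K powr (- (\<alpha> * a))" by simp
        also have "\<dots> < \<epsilon>" using N by (simp add: K_def)
        finally show ?thesis using tn nb by (intro exI[of _ t]) auto
      qed
      then show ?thesis by (auto simp: frequently_def eventually_at_top_linorder not_le) (meson leD)
    qed
    have "Liminf at_top (\<lambda>t. ereal (f t)) \<le> 0"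
    proof (rule ccontr)
      assume "\<not> ?thesis"
      then obtain \<epsilon> where \<epsilon>: "0 < ereal \<epsilon>" "ereal \<epsilon> < Liminf at_top (\<lambda>t. ereal (f t))"
        using ereal_dense2[of 0] by (auto simp: not_le)
      from less_LiminfD[OF \<epsilon>(2)] have "\<forall>\<^sub>F t in at_top. \<epsilon> < f t" by simp
      with small[of \<epsilon>] \<epsilon>(1) show False by (auto simp: frequently_def not_le)
    qed
    moreover have "0 \<le> Liminf at_top (\<lambda>t. ereal (f t))"
    proof (rule Liminf_bounded)
      show "\<forall>\<^sub>F t in at_top. 0 \<le> ereal (f t)"
        using eventually_ge_at_top[of 0]
        by eventually_elim (auto simp: f_def phi_alpha_def intro!: divide_nonneg_nonneg mult_nonneg_nonneg hk)
    qed
    ultimately show ?case unfolding f_def a_def by (rule antisym)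
  qed
qed

text \<open>The factor \<open>k^2\<close> in \<open>upper_growth\<close>, with
  \<open>k \<le> 2 * ln t\<close>, costs \<open>ln t powr (2/\<alpha>)\<close>. \<theta> exceeds
  \<open>2/\<alpha>\<close>, and the surplus power \<open>e\<close> of \<open>ln t\<close> beats the
  remaining power of \<open>ln (ln t)\<close>.\<close>

lemma liminf_infinite:
  assumes \<theta>: "\<theta> > 3 / \<alpha>"
  shows "AE \<omega> in M. Liminf at_top (\<lambda>t. ereal (heat_kernel (\<tau> \<omega>) t 0 0 * ln t powr \<theta> / phi_alpha \<alpha> t)) = \<infinity>"
  using AE_good upper_growth
proof eventually_elim
  case (elim \<omega>)
  from elim(1) interpret traps "\<tau> \<omega>" by (simp add: good_def)
  obtain k0 where k0: "\<And>k. k0 \<le> k \<Longrightarrow> S {-(2^k)..2^k} \<omega> \<le> (2 ^ k * real k ^ 2) powr (1/\<alpha>)"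
    using elim(2) by (auto simp: eventually_sequentially)
  define a where "a = 1 / (1 + \<alpha>)"
  define B where "B = 8 * (8 * C2) powr (1/\<alpha>)"
  have B: "0 < B" using C2_ge by (simp add: B_def)
  define e where "e = \<theta> - 2 / \<alpha>"
  have e: "0 < e" using \<theta> alpha by (simp add: e_def field_simps)
  have g: "0 < \<gamma> / \<alpha>" using exponents(1) alpha(1) by (rule divide_pos_pos)
  have "\<forall>\<^sub>F t in at_top. 2 ^ k0 \<le> \<rho> t"
    using rho_filterlim by (simp only: filterlim_at_top)
  moreover have "\<forall>\<^sub>F t in at_top. \<psi> t < 1 / (2 * C2)"
    using C2_ge by (intro order_tendstoD[OF psi_tendsto_0]) simp
  ultimately have "\<forall>\<^sub>F t in at_top. ln t powr e * ln (ln t) powr (- (\<gamma> / \<alpha>)) / B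
      \<le> heat_kernel (\<tau> \<omega>) t 0 0 * ln t powr \<theta> / phi_alpha \<alpha> t"
    using eventually_lnln kernel_lower[OF elim(1)]
  proof eventually_elim
    case (elim t)
    have "(1::real) \<le> 2 ^ k0" by simp
    with elim have t: "0 < t" "0 < ln (ln t)" "1 \<le> \<rho> t" "1 \<le> ln t" by linarith+
    have y: "1 \<le> C2 * \<rho> t" using C2_ge t by (intro mult_ge1_I) auto
    obtain k where k: "C2 * \<rho> t \<le> 2 ^ k" "2 ^ k \<le> 2 * (C2 * \<rho> t)" using dyadic_above[OF y] by metis
    have "\<rho> t \<le> C2 * \<rho> t" using C2_ge t by simp
    then have "(2::real) ^ k0 \<le> 2 ^ k" using elim k by linarith
    then have kk: "k0 \<le> k" by (auto simp: power_increasing_iff)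
    have "2 * (C2 * \<rho> t) = t * (2 * C2 * \<psi> t)" by (simp add: \<rho>_def)
    also have "\<dots> \<le> t * 1" using elim t C2_ge by (intro mult_left_mono) (auto simp: field_simps)
    finally have "2 ^ k \<le> t" using k by linarith
    then have kl: "real k \<le> 2 * ln t" by (rule exponent_le_ln)
    have "S {-(2^k)..2^k} \<omega> \<le> (2 ^ k * real k ^ 2) powr (1/\<alpha>)" by (rule k0) fact
    also have "\<dots> \<le> ((2 * (C2 * \<rho> t)) * (2 * ln t) ^ 2) powr (1/\<alpha>)"
      using k kl alpha t C2_ge by (intro powr_mono2 mult_mono power_mono) auto
    also have "(2 * (C2 * \<rho> t)) * (2 * ln t) ^ 2 = (8 * C2) * (\<rho> t * (ln t) ^ 2)"
      by (simp add: power2_eq_square)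
    also have "\<dots> powr (1/\<alpha>) = (8 * C2) powr (1/\<alpha>) * (\<rho> t powr (1/\<alpha>) * ((ln t) ^ 2) powr (1/\<alpha>))"
      using t C2_ge by (simp add: powr_mult)
    also have "((ln t) ^ 2) powr (1/\<alpha>) = ln t powr (2/\<alpha>)"
    proof -
      have "0 \<le> ln t" using t by linarith
      then have "(ln t) ^ 2 = ln t powr 2" by (simp only: powr_numeral)
      then show ?thesis by (simp add: powr_powr)
    qed
    also have "\<rho> t powr (1/\<alpha>) = t powr a * ln (ln t) powr (\<gamma> / \<alpha>)"
      unfolding a_def by (rule rho_powr[OF t(1,2)])
    finally have "8 * S {-(2^k)..2^k} \<omega> \<le> B * (t powr a * ln (ln t) powr (\<gamma> / \<alpha>) * ln t powr (2/\<alpha>))"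
      by (simp add: B_def mult_ac)
    moreover have "0 < S {-(2^k)..2^k} \<omega>" by (intro sum_pos) auto
    moreover have "0 < B * (t powr a * ln (ln t) powr (\<gamma> / \<alpha>) * ln t powr (2/\<alpha>))"
    proof -
      have "ln t \<noteq> 0" using t(4) by linarith
      then show ?thesis using B t(1,2) by (intro mult_pos_pos) (simp_all only: powr_gt_zero, auto)
    qed
    ultimately have "1 / (B * (t powr a * ln (ln t) powr (\<gamma> / \<alpha>) * ln t powr (2/\<alpha>))) \<le> 1 / (8 * S {-(2^k)..2^k} \<omega>)"
      by (intro frac_le) auto
    also have "\<dots> \<le> heat_kernel (\<tau> \<omega>) t 0 0"
      using elim(4)[rule_format, of "2 ^ k"] k by simp
    finally have hk: "1 / (B * (t powr a * ln (ln t) powr (\<gamma> / \<alpha>) * ln t powr (2/\<alpha>))) \<le> heat_kernel (\<tau> \<omega>) t 0 0" .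
    have "ln t powr e * ln (ln t) powr (- (\<gamma> / \<alpha>)) / B
      = 1 / (B * (t powr a * ln (ln t) powr (\<gamma> / \<alpha>) * ln t powr (2/\<alpha>))) * (ln t powr \<theta> * t powr a)"
      using t B by (simp add: e_def powr_diff powr_minus field_simps)
    also have "\<dots> \<le> heat_kernel (\<tau> \<omega>) t 0 0 * (ln t powr \<theta> * t powr a)"
      using hk by (intro mult_right_mono) auto
    also have "\<dots> = heat_kernel (\<tau> \<omega>) t 0 0 * ln t powr \<theta> / phi_alpha \<alpha> t"
      by (simp add: phi_alpha_def a_def powr_minus divide_inverse mult_ac)
    finally show ?case .
  qed
  moreover have "filterlim (\<lambda>t. ln t powr e * ln (ln t) powr (- (\<gamma> / \<alpha>)) / B) at_top at_top"
    using e g B by real_asymp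
  ultimately have "filterlim (\<lambda>t. heat_kernel (\<tau> \<omega>) t 0 0 * ln t powr \<theta> / phi_alpha \<alpha> t) at_top at_top"
    by (rule filterlim_at_top_mono[rotated])
  then have "((\<lambda>t. ereal (heat_kernel (\<tau> \<omega>) t 0 0 * ln t powr \<theta> / phi_alpha \<alpha> t)) \<longlongrightarrow> \<infinity>) at_top"
    by (simp add: tendsto_PInfty_eq_at_top)
  then show ?case by (intro lim_imp_Liminf) auto
qed

end

theorem mainTheorem1:
  fixes M :: "'w measure" and \<tau> :: "'w \<Rightarrow> int \<Rightarrow> real" and \<alpha> :: real
  assumes "prob_space M"
    and "0 < \<alpha>" and "\<alpha> < 1"
    and "\<And>x. (\<lambda>\<omega>. \<tau> \<omega> x) \<in> borel_measurable M"
    and "prob_space.indep_vars M (\<lambda>_. borel) (\<lambda>x \<omega>. \<tau> \<omega> x) UNIV"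
    and "\<And>x u. 1 \<le> u \<Longrightarrow> measure M {\<omega> \<in> space M. \<tau> \<omega> x > u} = u powr (- \<alpha>)"
  shows "(AE \<omega> in M.
            0 < Limsup at_top (\<lambda>t. ereal (heat_kernel (\<tau> \<omega>) t 0 0 /
                   (phi_alpha \<alpha> t * ln (ln t) powr ((1 - \<alpha>) / (1 + \<alpha>))))) \<and>
            Limsup at_top (\<lambda>t. ereal (heat_kernel (\<tau> \<omega>) t 0 0 /
                   (phi_alpha \<alpha> t * ln (ln t) powr ((1 - \<alpha>) / (1 + \<alpha>))))) < \<infinity>)
       \<and> (AE \<omega> in M.
            Liminf at_top (\<lambda>t. ereal (heat_kernel (\<tau> \<omega>) t 0 0 * ln t powr (1 / (1 + \<alpha>))
                   / phi_alpha \<alpha> t)) = 0)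
       \<and> (\<forall>\<theta>. \<theta> > 3 / \<alpha> \<longrightarrow> (AE \<omega> in M.
            Liminf at_top (\<lambda>t. ereal (heat_kernel (\<tau> \<omega>) t 0 0 * ln t powr \<theta>
                   / phi_alpha \<alpha> t)) = \<infinity>))"
proof -
  interpret heavy_tailed_traps M \<tau> \<alpha>
    using assms by (intro heavy_tailed_traps.intro heavy_tailed_traps_axioms.intro)
  \<comment> \<open>Folds the normaliser of the statement into \<open>\<psi>\<close>, in which the
    limsup lemmas are phrased.\<close>
  note [simp] = \<psi>_def[unfolded \<gamma>_def, symmetric]
  show ?thesis
    using limsup_positive limsup_finite liminf_zero liminf_infinite by simp
qed

end
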